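(* For every integer $k\ge 1$, $$\zeta(4k+1)=\frac{(2\pi)^{4k+1}}{2b_k}\sum_{j=0}^k \frac{(-1)^{j+1}\, c_{jk}\, B_{2j}\, B_{4k+2-2j}}{(2j)!\,(4k+2-2j)!}-\frac{1}{2^{4k-1}b_k}\,\mathcal{L}_{e^{-4\pi}}(-4k-1)+\frac{(-1)^k2^{2k+1}a_k}{b_k}\,\mathcal{L}_{-e^{-5\pi}}(-4k-1)+\frac{2a_k}{b_k}\,\mathcal{L}_{e^{-10\pi}}(-4k-1),$$ where $$a_k=\frac{2^{4k+1}-(-1)^k2^{2k}+1}{2^{4k}\left[5^{4k+1}-2\times5^{2k}\cos(4k\tan^{-1}2)+1\right]},$$ $$b_k=\frac{a_k}{2}\bigg[5^{4k+1}-\sum_{n=-2}^{2}(1+in)^{4k}\bigg]-\frac{2^{4k+1}-(-1)^k2^{2k}-1}{2^{4k+1}},$$ $$c_{jk}=a_k\bigg[5^{2j-1}\sum_{n=-2}^{2}(1+in)^{4k+1-2j}-5^{4k+1-2j}\sum_{n=-2}^{2}(1+in)^{2j-1}\bigg]-\bigg[\frac{1+(1+i)^{4k+1-2j}}{2^{4k+1-2j}}-\frac{1+(1+i)^{2j-1}}{2^{2j-1}}\bigg].$$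
   Context: For complex $q$ with $|q|<1$ and $s\in\mathbb{C}$, the Lambert series is $\mathcal{L}_q(s)=\sum_{n=1}^\infty \frac{n^s q^n}{1-q^n}$. $\zeta$ is the Riemann zeta function, $B_m$ is the $m$th Bernoulli number, $i=\sqrt{-1}$ (the coefficients $c_{jk}$ are in general complex numbers), and $\tan^{-1}$ is the arctangent. *)

theory Defs
  imports "HOL-Analysis.Analysis" "HOL-Computational_Algebra.Formal_Power_Series"
begin

text \<open>
  The Riemann zeta function is given by its Dirichlet series, so the constant below is meaningful
  only on the half-plane \<open>Re s > 1\<close>; the analytic continuation is not defined here.
\<close>

definition zeta :: "complex \<Rightarrow> complex" where
  "zeta s = (\<Sum>n. 1 / of_nat (Suc n) powr s)"

text \<open>
  The exponential generating function of the Bernoulli numbers is \<open>x / (exp x - 1)\<close>, a formal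
  power series because both series have order 1. Hence \<open>bernoulli 1 = - 1 / 2\<close>.
\<close>

definition bernoulli :: "nat \<Rightarrow> real" where
  "bernoulli m = fact m * fps_nth (fps_X / (fps_exp 1 - 1)) m"

text \<open>The Lambert series is meaningful for \<open>norm q < 1\<close>; the summation index is \<open>Suc n\<close>.\<close>

definition lambert :: "complex \<Rightarrow> complex \<Rightarrow> complex" where
  "lambert q s = (\<Sum>n. of_nat (Suc n) powr s * q ^ Suc n / (1 - q ^ Suc n))"

definition coeff_a :: "nat \<Rightarrow> real" where
  "coeff_a k =
     (2 ^ (4 * k + 1) - (-1) ^ k * 2 ^ (2 * k) + 1) /
     (2 ^ (4 * k) * (5 ^ (4 * k + 1) - 2 * 5 ^ (2 * k) * cos (4 * real k * arctan 2) + 1))"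

definition coeff_b :: "nat \<Rightarrow> complex" where
  "coeff_b k =
     of_real (coeff_a k) / 2 *
       (5 ^ (4 * k + 1) - (\<Sum>n\<in>{-2..2::int}. (1 + \<i> * of_int n) ^ (4 * k)))
     - (2 ^ (4 * k + 1) - (-1) ^ k * 2 ^ (2 * k) - 1) / 2 ^ (4 * k + 1)"

text \<open>Integer powers are needed below: the exponent \<open>2 * j - 1\<close> is \<open>-1\<close> when \<open>j = 0\<close>.\<close>

definition coeff_c :: "nat \<Rightarrow> nat \<Rightarrow> complex" where
  "coeff_c j k =
     of_real (coeff_a k) *
       (5 powi (2 * int j - 1) *
          (\<Sum>n\<in>{-2..2::int}. (1 + \<i> * of_int n) powi (4 * int k + 1 - 2 * int j))
        - 5 powi (4 * int k + 1 - 2 * int j) *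
          (\<Sum>n\<in>{-2..2::int}. (1 + \<i> * of_int n) powi (2 * int j - 1)))
     - ((1 + (1 + \<i>) powi (4 * int k + 1 - 2 * int j)) / 2 powi (4 * int k + 1 - 2 * int j)
        - (1 + (1 + \<i>) powi (2 * int j - 1)) / 2 powi (2 * int j - 1))"

end

theory Submission
  imports Defs
begin

text \<open>
  Put \<open>Z \<tau> = zeta s + 2 * lambert (exp (2 * pi * \<i> * \<tau>)) (- s)\<close> with \<open>s = 4 * k + 1\<close>; up to a
  constant factor this is \<open>\<Sum>m. cot (pi * m * \<tau>) / m ^ s\<close>. Expanding the cotangent into partial
  fractions and adding the same double series for \<open>- 1 / \<tau>\<close> with the summation order exchanged, the
  summand telescopes into a finite sum of products of even zeta values. Hence
  \<open>Z \<tau> - \<tau> ^ (4 * k) * Z (- 1 / \<tau>)\<close> is an explicit Laurent polynomial whose coefficients are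
  products of Bernoulli numbers (Ramanujan's formula).
  Moreover \<open>Z\<close> has period 1 and is an eigenfunction of the Hecke operators, which relates the values
  at \<open>p * \<tau>\<close> and \<open>(\<tau> + b) / p\<close> to the value at \<open>\<tau>\<close>. At \<open>\<tau> = \<i>\<close> the reflection brings every
  point that occurs for \<open>p = 2\<close> back to \<open>\<i>\<close> or \<open>2 * \<i>\<close>, and every point for \<open>p = 5\<close> back to
  \<open>\<i>\<close>, \<open>5 * \<i>\<close> or \<open>(1 + 5 * \<i>) / 2\<close>. Eliminating \<open>Z \<i>\<close> from the two relations gives the theorem.
\<close>

text \<open>Both \<open>Infinite_Sum\<close> and \<open>Infinite_Set_Sum\<close> declare this infix; the former is meant below.\<close>

no_notation Infinite_Set_Sum.abs_summable_on (infix \<open>abs'_summable'_on\<close> 50)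

section \<open>Series over the positive integers\<close>

lemma has_sum_Suc_iff:
  "((\<lambda>n. f (Suc n)) has_sum S) UNIV \<longleftrightarrow> (f has_sum S) {1..}"
proof -
  have "Suc ` UNIV = {1..}"
    by (auto simp: image_iff) (metis Suc_le_D)
  then show ?thesis
    using has_sum_reindex[of Suc UNIV f S] by (simp add: o_def)
qed

lemma abs_summable_on_atLeast_1:
  fixes f :: "nat \<Rightarrow> 'a::banach"
  assumes "summable (\<lambda>n. norm (f (Suc n)))"
  shows "f abs_summable_on {1..}"
proof -
  have "(\<lambda>n. norm (f (Suc n))) summable_on UNIV"
    using assms by (intro norm_summable_imp_summable_on) simp
  then show ?thesis
    using has_sum_Suc_iff[of "\<lambda>n. norm (f n)"] by (auto simp: summable_on_def)
qed

lemma abs_summable_inverse_power: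
  assumes "s \<ge> 2"
  shows "(\<lambda>n. 1 / of_nat n ^ s :: complex) abs_summable_on {1..}"
proof (rule abs_summable_on_atLeast_1)
  have "summable (\<lambda>n. inverse (of_nat (Suc n) ^ s) :: real)"
    using inverse_power_summable[OF assms, where ?'a = real] by (subst summable_Suc_iff)
  then show "summable (\<lambda>n. norm (1 / of_nat (Suc n) ^ s :: complex))"
    by (simp add: norm_inverse norm_power divide_inverse del: of_nat_Suc)
qed

lemma of_nat_Suc_powr_minus:
  "(of_nat (Suc n) :: complex) powr (- of_nat s) = 1 / of_nat (Suc n) ^ s"
  by (simp add: powr_minus powr_nat divide_inverse del: of_nat_Suc)

lemma zeta_has_sum:
  assumes "s \<ge> 2"
  shows "((\<lambda>n. 1 / of_nat n ^ s) has_sum zeta (of_nat s)) {1..}"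
proof -
  have "((\<lambda>n. 1 / of_nat n ^ s :: complex) has_sum (\<Sum>\<^sub>\<infinity>n\<in>{1..}. 1 / of_nat n ^ s)) {1..}"
    by (rule has_sum_infsum[OF abs_summable_summable[OF abs_summable_inverse_power[OF assms]]])
  moreover from this have "(\<lambda>n. 1 / of_nat (Suc n) ^ s :: complex) sums (\<Sum>\<^sub>\<infinity>n\<in>{1..}. 1 / of_nat n ^ s)"
    by (subst (asm) has_sum_Suc_iff[symmetric]) (rule has_sum_imp_sums)
  moreover have "zeta (of_nat s) = (\<Sum>n. 1 / of_nat (Suc n) ^ s)"
    unfolding zeta_def by (simp add: powr_nat del: of_nat_Suc)
  ultimately show ?thesis
    by (simp add: sums_iff)
qed

text \<open>For \<open>n \<ge> 1\<close> the bound \<open>norm q ^ n \<le> norm q\<close> keeps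
  \<open>1 - q ^ n\<close> uniformly away from 0, so the series is dominated by a constant multiple
  of the series of \<open>1 / n ^ s\<close>.\<close>

lemma lambert_has_sum:
  assumes q: "norm q < 1" and s: "s \<ge> 2"
  shows "((\<lambda>n. q ^ n / (1 - q ^ n) / of_nat n ^ s) has_sum lambert q (- of_nat s)) {1..}"
proof -
  have bound: "norm (q ^ n / (1 - q ^ n) / of_nat n ^ s)
      \<le> norm (1 / of_real (1 - norm q) * (1 / of_nat n ^ s :: complex))" if "n \<in> {1..}" for n
  proof -
    have pow: "norm q ^ n \<le> norm q"
      using that q power_decreasing[of 1 n "norm q"] by simp
    have "1 - norm q \<le> norm (1 - q ^ n)"
      using norm_triangle_ineq2[of 1 "q ^ n"] pow by (simp add: norm_power)
    then have "norm (q ^ n / (1 - q ^ n)) \<le> 1 / (1 - norm q)"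
      unfolding norm_divide norm_power using q pow by (intro frac_le) auto
    then have "norm (q ^ n / (1 - q ^ n)) / real n ^ s \<le> 1 / (1 - norm q) / real n ^ s"
      by (intro divide_right_mono) auto
    moreover have "norm (complex_of_real (1 - norm q)) = 1 - norm q"
      using q by (metis norm_of_real abs_of_pos diff_gt_0_iff_gt)
    ultimately show ?thesis
      by (simp add: norm_divide norm_mult norm_power del: of_real_diff)
  qed
  have "(\<lambda>n. 1 / of_real (1 - norm q) * (1 / of_nat n ^ s :: complex)) abs_summable_on {1..}"
    using abs_summable_inverse_power[OF s] unfolding norm_mult by (rule summable_on_cmult_right)
  then have "(\<lambda>n. q ^ n / (1 - q ^ n) / of_nat n ^ s) abs_summable_on {1..}"
    using bound by (rule Infinite_Sum.abs_summable_on_comparison_test)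
  from has_sum_infsum[OF abs_summable_summable[OF this]]
  have *: "((\<lambda>n. q ^ n / (1 - q ^ n) / of_nat n ^ s) has_sum
      (\<Sum>\<^sub>\<infinity>n\<in>{1..}. q ^ n / (1 - q ^ n) / of_nat n ^ s)) {1..}"
    by simp
  then have "(\<lambda>n. q ^ Suc n / (1 - q ^ Suc n) / of_nat (Suc n) ^ s) sums
      (\<Sum>\<^sub>\<infinity>n\<in>{1..}. q ^ n / (1 - q ^ n) / of_nat n ^ s)"
    by (subst (asm) has_sum_Suc_iff[symmetric]) (rule has_sum_imp_sums)
  moreover have "lambert q (- of_nat s) = (\<Sum>n. q ^ Suc n / (1 - q ^ Suc n) / of_nat (Suc n) ^ s)"
    unfolding lambert_def of_nat_Suc_powr_minus by (simp add: mult.commute)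
  ultimately show ?thesis
    using * by (simp add: sums_iff)
qed

section \<open>The cotangent series\<close>

text \<open>Differentiating the reflection formula
  \<open>Gamma z * Gamma (1 - z) = pi / sin (pi * z)\<close> expresses the cotangent as a difference
  of two Digamma values; the Digamma series then gives the partial fractions term by term.\<close>

lemma cot_pi_partial_fractions_sums:
  fixes z :: complex
  assumes z: "z \<notin> \<int>"
  shows "(\<lambda>n. 2 * z / (z\<^sup>2 - of_nat (Suc n) ^ 2)) sums (pi * cot (pi * z) - 1 / z)"
proof -
  have nz: "z \<noteq> 0" "1 - z \<notin> \<int>" "- z \<notin> \<int>" "1 + z \<notin> \<int>"
    using z by (auto simp: minus_in_Ints_iff)
  have notnpi: "w \<notin> \<int>\<^sub>\<le>\<^sub>0" if "w \<notin> \<int>" for w :: complex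
    using that nonpos_Ints_Int by blast
  have sin_nz: "sin (pi * z) \<noteq> 0"
    using z sin_eq_0[of "pi * z"] by (auto simp: mult.commute)
  have "((\<lambda>w. Gamma w * Gamma (1 - w)) has_field_derivative
      Gamma z * Gamma (1 - z) * (Digamma z - Digamma (1 - z))) (at z)"
    using notnpi[OF z] notnpi[OF nz(2)]
    by (auto intro!: derivative_eq_intros simp: algebra_simps)
  moreover have "((\<lambda>w. complex_of_real pi / sin (pi * w)) has_field_derivative
      pi / sin (pi * z) * (- pi * cot (pi * z))) (at z)"
    using sin_nz by (auto intro!: derivative_eq_intros simp: cot_def field_simps)
  ultimately have "Gamma z * Gamma (1 - z) * (Digamma z - Digamma (1 - z)) =
      pi / sin (pi * z) * (- pi * cot (pi * z))"
    unfolding Gamma_reflection_complex using DERIV_unique by blast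
  then have refl: "Digamma (1 - z) - Digamma z = pi * cot (pi * z)"
    using sin_nz unfolding Gamma_reflection_complex
    by (simp add: divide_simps) (metis minus_diff_eq mult_minus_right minus_minus mult_left_cancel of_real_eq_0_iff pi_neq_zero)
  have S: "(\<lambda>k. inverse (of_nat (Suc k)) - inverse (w + of_nat k)) sums (Digamma w + euler_mascheroni)"
    if "w \<notin> \<int>" for w :: complex
  proof -
    have "w \<noteq> 0" using that by auto
    from summable_sums[OF summable_Digamma[OF this]] show ?thesis
      by (simp add: Digamma_def)
  qed
  \<comment> \<open>Passing from \<open>Digamma z\<close> to \<open>Digamma (1 + z)\<close> absorbs
    the pole \<open>1 / z\<close>; the series at \<open>1 - z\<close> and at \<open>1 + z\<close>
    then pair up index by index.\<close>
  have "Digamma (z + 1) = Digamma z + 1 / z"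
    using nz(1) by (rule Digamma_plus1)
  with refl have val: "pi * cot (pi * z) - 1 / z = Digamma (1 - z) - Digamma (1 + z)"
    by (simp add: add.commute algebra_simps)
  have eq: "inverse (1 + z + of_nat n) - inverse (1 - z + of_nat n) =
      2 * z / (z\<^sup>2 - of_nat (Suc n) ^ 2)" for n
  proof -
    have "1 + z + of_nat n \<noteq> 0" "1 - z + of_nat n \<noteq> 0"
      using plus_of_nat_eq_0_imp[of "1 + z" n] plus_of_nat_eq_0_imp[of "1 - z" n]
        notnpi[OF nz(4)] notnpi[OF nz(2)] by auto
    then have "inverse (1 + z + of_nat n) - inverse (1 - z + of_nat n) =
        (1 - z + of_nat n - (1 + z + of_nat n)) / ((1 + z + of_nat n) * (1 - z + of_nat n))"
      by (simp add: divide_simps)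
    also have "\<dots> = - (2 * z) / - (z\<^sup>2 - of_nat (Suc n) ^ 2)"
      by (rule arg_cong2[where f = divide]) (simp_all add: power2_eq_square algebra_simps)
    finally show ?thesis by (simp only: minus_divide_divide)
  qed
  from sums_diff[OF S[OF nz(2)] S[OF nz(4)]] show ?thesis
    by (simp add: val eq del: of_nat_Suc)
qed

lemma abs_summable_on_times:
  fixes a :: "'a \<Rightarrow> complex" and b :: "'b \<Rightarrow> complex"
  assumes "a abs_summable_on A" "b abs_summable_on B"
  shows "(\<lambda>(m, n). a m * b n) abs_summable_on A \<times> B"
proof (rule Infinite_Sum.abs_summable_on_Sigma_iff[THEN iffD2], intro conjI ballI)
  show "(\<lambda>n. case (m, n) of (m, n) \<Rightarrow> a m * b n) abs_summable_on B" for m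
    using summable_on_cmult_right[OF assms(2), of "norm (a m)"] by (simp add: norm_mult)
  have "(\<lambda>m. norm (a m) * (\<Sum>\<^sub>\<infinity>n\<in>B. norm (b n))) summable_on A"
    using assms(1) by (rule summable_on_cmult_left)
  then show "(\<lambda>m. \<Sum>\<^sub>\<infinity>n\<in>B. norm (case (m, n) of (m, n) \<Rightarrow> a m * b n)) abs_summable_on A"
    by (simp add: norm_mult infsum_cmult_right' infsum_nonneg)
qed

lemma has_sum_times:
  fixes a :: "'a \<Rightarrow> complex" and b :: "'b \<Rightarrow> complex"
  assumes "a abs_summable_on A" "b abs_summable_on B" "(a has_sum x) A" "(b has_sum y) B"
  shows "((\<lambda>(m, n). a m * b n) has_sum (x * y)) (A \<times> B)"
proof (rule has_sum_SigmaI)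
  show "((\<lambda>n. case (m, n) of (m, n) \<Rightarrow> a m * b n) has_sum a m * y) B" for m
    using has_sum_cmult_right[OF assms(4), of "a m"] by simp
  show "((\<lambda>m. a m * y) has_sum x * y) A"
    using assms(3) by (rule has_sum_cmult_left)
  show "(\<lambda>(m, n). a m * b n) summable_on A \<times> B"
    by (rule abs_summable_summable[OF abs_summable_on_times[OF assms(1,2)]])
qed

text \<open>With \<open>w = exp (\<i> * (pi * z))\<close> the cotangent is a rational function of
  \<open>w\<^sup>2\<close>. This form exhibits the Lambert summand
  \<open>q / (1 - q)\<close>.\<close>

lemma cot_pi_eq_exp:
  fixes z :: complex
  assumes "exp (2 * pi * \<i> * z) \<noteq> 1"
  shows "cot (pi * z) = - \<i> * (1 + 2 * (exp (2 * pi * \<i> * z) / (1 - exp (2 * pi * \<i> * z))))"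
proof -
  define w where "w = exp (\<i> * (pi * z))"
  have w: "w \<noteq> 0" "exp (2 * pi * \<i> * z) = w\<^sup>2" "exp (- (\<i> * (pi * z))) = 1 / w"
    by (simp_all add: w_def exp_minus divide_inverse power2_eq_square mult_ac flip: exp_add)
  have "1 - w\<^sup>2 \<noteq> 0"
    using assms w(2) by auto
  have "cot (pi * z) = ((w + 1 / w) / 2) / ((w - 1 / w) / (2 * \<i>))"
    unfolding cot_def cos_exp_eq sin_exp_eq w(3) w_def[symmetric] by simp
  also have "\<dots> = \<i> * (w\<^sup>2 + 1) / (w\<^sup>2 - 1)"
  proof -
    have "w + 1 / w = (w\<^sup>2 + 1) / w" "w - 1 / w = (w\<^sup>2 - 1) / w"
      using w(1) by (simp_all add: field_simps power2_eq_square)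
    then show ?thesis
      using w(1) \<open>1 - w\<^sup>2 \<noteq> 0\<close> by (simp add: divide_simps)
  qed
  also have "\<dots> = - \<i> * (1 + 2 * (w\<^sup>2 / (1 - w\<^sup>2)))"
    using \<open>1 - w\<^sup>2 \<noteq> 0\<close> by (simp add: divide_simps) (simp add: algebra_simps)
  finally show ?thesis
    unfolding w(2) .
qed

text \<open>The function \<open>Z\<close> of the overview. For odd \<open>s \<ge> 3\<close> its
  Lambert part is, up to a factor, the \<open>s\<close>-fold integral of the nonconstant part of the
  Eisenstein series of weight \<open>s + 1\<close>, which is the source of its reflection law and
  Hecke relations.\<close>

definition zeta_lambert :: "nat \<Rightarrow> complex \<Rightarrow> complex" where
  "zeta_lambert s \<tau> = zeta (of_nat s) + 2 * lambert (exp (2 * pi * \<i> * \<tau>)) (- of_nat s)"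

text \<open>In the exponential form of the cotangent, the constant 1 sums to the zeta value and the
  remainder to twice the Lambert series; \<open>norm q < 1\<close> keeps every \<open>q ^ m\<close>
  off the pole at 1.\<close>

lemma cot_series_has_sum:
  fixes \<tau> :: complex
  assumes \<tau>: "Im \<tau> > 0" and s: "s \<ge> 2"
  shows "((\<lambda>m. pi * cot (pi * (of_nat m * \<tau>)) / of_nat m ^ s) has_sum
           (- \<i> * pi * zeta_lambert s \<tau>)) {1..}"
proof -
  define q where "q = exp (2 * pi * \<i> * \<tau>)"
  have q: "norm q < 1"
    using \<tau> by (simp add: q_def)
  have "((\<lambda>m. - \<i> * pi * (1 / of_nat m ^ s + 2 * (q ^ m / (1 - q ^ m) / of_nat m ^ s))) has_sum
      (- \<i> * pi * zeta_lambert s \<tau>)) {1..}"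
    unfolding zeta_lambert_def q_def[symmetric]
    by (intro has_sum_cmult_right has_sum_add zeta_has_sum lambert_has_sum q s)
  also have "?this \<longleftrightarrow> ?thesis"
  proof (rule has_sum_cong)
    fix m :: nat assume m: "m \<in> {1..}"
    have qm: "exp (2 * pi * \<i> * (of_nat m * \<tau>)) = q ^ m"
      unfolding q_def by (simp add: mult_ac flip: exp_of_nat_mult)
    have "norm q ^ m < 1"
      using q m by (simp add: power_less_one_iff)
    then have "norm (q ^ m) \<noteq> norm (1::complex)"
      by (simp add: norm_power)
    then have "q ^ m \<noteq> 1" by metis
    then have "cot (pi * (of_nat m * \<tau>)) = - \<i> * (1 + 2 * (q ^ m / (1 - q ^ m)))"
      using cot_pi_eq_exp[of "of_nat m * \<tau>"] qm by simp
    then show "- \<i> * pi * (1 / of_nat m ^ s + 2 * (q ^ m / (1 - q ^ m) / of_nat m ^ s)) =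
        pi * cot (pi * (of_nat m * \<tau>)) / of_nat m ^ s"
      unfolding \<open>cot (pi * (of_nat m * \<tau>)) = _\<close>
      by (simp only: divide_inverse algebra_simps)
  qed
  finally show ?thesis .
qed

section \<open>The lattice double series and its absolute convergence\<close>

lemma norm_lattice_lower_bound:
  fixes m n :: real
  assumes "Im \<tau> \<noteq> 0" "n \<ge> 0"
  shows "norm (of_real m * \<tau> + of_real n) \<ge> n * \<bar>Im \<tau>\<bar> / norm \<tau>"
    and "norm (of_real m * \<tau> - of_real n) \<ge> n * \<bar>Im \<tau>\<bar> / norm \<tau>"
proof -
  have gen: "\<bar>x\<bar> * \<bar>Im \<tau>\<bar> / norm \<tau> \<le> norm (of_real m * \<tau> + of_real x)" for x
  proof -
    \<comment> \<open>Multiplying by \<open>cnj \<tau>\<close> makes the \<open>m\<close> term real,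
      so only \<open>x\<close> contributes to the imaginary part and the bound is uniform in
      \<open>m\<close>.\<close>
    have "\<bar>x\<bar> * \<bar>Im \<tau>\<bar> = \<bar>Im ((of_real m * \<tau> + of_real x) * cnj \<tau>)\<bar>"
      by (simp add: abs_mult algebra_simps)
    also have "\<dots> \<le> norm (of_real m * \<tau> + of_real x) * norm \<tau>"
      by (metis abs_Im_le_cmod norm_mult complex_mod_cnj)
    finally show ?thesis
      using assms(1) by (auto simp: divide_simps)
  qed
  show "norm (of_real m * \<tau> + of_real n) \<ge> n * \<bar>Im \<tau>\<bar> / norm \<tau>"
    and "norm (of_real m * \<tau> - of_real n) \<ge> n * \<bar>Im \<tau>\<bar> / norm \<tau>"
    using gen[of n] gen[of "- n"] assms(2) by auto
qed

text \<open>The difference of squares factors into the two linear forms just bounded. The quadratic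
  growth in \<open>n\<close>, uniform in \<open>m\<close>, is what makes the double series converge
  absolutely.\<close>

lemma norm_quadratic_lower_bound:
  fixes \<tau> :: complex and m n :: nat
  assumes "Im \<tau> \<noteq> 0"
  shows "norm ((of_nat m * \<tau>)\<^sup>2 - of_nat n ^ 2) \<ge> (\<bar>Im \<tau>\<bar> / norm \<tau>)\<^sup>2 * real n ^ 2"
proof -
  have "(real n * \<bar>Im \<tau>\<bar> / norm \<tau>) * (real n * \<bar>Im \<tau>\<bar> / norm \<tau>) \<le>
      norm (of_nat m * \<tau> + of_nat n) * norm (of_nat m * \<tau> - of_nat n)"
    using norm_lattice_lower_bound[OF assms, of "real n" "real m"] by (intro mult_mono) auto
  also have "\<dots> = norm ((of_nat m * \<tau>)\<^sup>2 - of_nat n ^ 2)"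
    by (simp add: power2_eq_square algebra_simps flip: norm_mult)
  finally show ?thesis
    by (simp add: power2_eq_square mult_ac)
qed

text \<open>Summing over \<open>n\<close> first is the partial fraction expansion at
  \<open>m * \<tau>\<close>, whose pole term \<open>1 / z\<close> accounts for
  \<open>zeta (of_nat (2 * N + 2)) / \<tau>\<close>. Stating the sum over pairs permits the later
  exchange of the two indices.\<close>

lemma cot_double_series_has_sum:
  fixes \<tau> :: complex
  assumes \<tau>: "Im \<tau> > 0" and N: "N \<ge> 1"
  shows "((\<lambda>(m, n). 2 * \<tau> / ((of_nat m * \<tau>)\<^sup>2 - of_nat n ^ 2) / of_nat m ^ (2 * N)) has_sum
          (- \<i> * pi * zeta_lambert (2 * N + 1) \<tau> - zeta (of_nat (2 * N + 2)) / \<tau>)) ({1..} \<times> {1..})"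
    (is "(?f has_sum _) _")
proof (rule has_sum_SigmaI)
  define c where "c = (\<bar>Im \<tau>\<bar> / norm \<tau>)\<^sup>2"
  have c: "c > 0" using \<tau> by (auto simp: c_def)
  have "(\<lambda>x. of_real (2 * norm \<tau> / c) * (case x of (m, n) \<Rightarrow> (1 / of_nat m ^ (2 * N) * (1 / of_nat n ^ 2) :: complex)))
      abs_summable_on ({1..} \<times> {1..})"
    unfolding norm_mult using N
    by (intro summable_on_cmult_right abs_summable_on_times abs_summable_inverse_power) auto
  moreover have "norm (?f x) \<le> norm (of_real (2 * norm \<tau> / c) *
      (case x of (m, n) \<Rightarrow> (1 / of_nat m ^ (2 * N) * (1 / of_nat n ^ 2) :: complex)))"
    if x_in: "x \<in> {1..} \<times> {1..}" for x
  proof -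
    obtain m n where x: "x = (m, n)" "m \<ge> 1" "n \<ge> 1"
      using x_in by auto
    have "2 * norm \<tau> / norm ((of_nat m * \<tau>)\<^sup>2 - of_nat n ^ 2) \<le> 2 * norm \<tau> / (c * real n ^ 2)"
      using norm_quadratic_lower_bound[of \<tau> n m] \<tau> c x
      by (intro frac_le mult_pos_pos) (auto simp: c_def)
    then have "2 * norm \<tau> / norm ((of_nat m * \<tau>)\<^sup>2 - of_nat n ^ 2) / real m ^ (2 * N)
        \<le> 2 * norm \<tau> / (c * real n ^ 2) / real m ^ (2 * N)"
      by (rule divide_right_mono) simp
    then show ?thesis
      using c by (simp add: x norm_mult norm_divide norm_power mult_ac)
  qed
  ultimately have "?f abs_summable_on ({1..} \<times> {1..})"
    by (rule Infinite_Sum.abs_summable_on_comparison_test)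
  then show "?f summable_on ({1..} \<times> {1..})"
    by (rule abs_summable_summable)
next
  fix m :: nat assume "m \<in> {1..}"
  then have m: "m > 0" by auto
  define z where "z = of_nat m * \<tau>"
  have Imz: "Im z > 0"
    using m \<tau> by (simp add: z_def)
  then have z: "z \<notin> \<int>"
    by (auto elim!: Ints_cases)
  have "\<tau> \<noteq> 0" using \<tau> by auto
  have "((\<lambda>n. 2 * z / (z\<^sup>2 - of_nat (Suc n) ^ 2)) has_sum (pi * cot (pi * z) - 1 / z)) UNIV"
  proof (rule norm_summable_imp_has_sum[OF _ cot_pi_partial_fractions_sums[OF z]])
    define c where "c = (\<bar>Im z\<bar> / norm z)\<^sup>2"
    have c: "c > 0" using Imz by (auto simp: c_def)
    have "summable (\<lambda>n. inverse (real (Suc n) ^ 2))"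
      using inverse_power_summable[of 2, where ?'a = real] by (subst summable_Suc_iff) auto
    then have "summable (\<lambda>n. 2 * norm z / c * inverse (real (Suc n) ^ 2))"
      by (rule summable_mult)
    then show "summable (\<lambda>n. norm (2 * z / (z\<^sup>2 - of_nat (Suc n) ^ 2)))"
    proof (rule summable_comparison_test')
      fix n :: nat
      \<comment> \<open>The lattice bound is applied with \<open>z\<close> in place of
        \<open>\<tau>\<close> and with \<open>m = 1\<close>.\<close>
      have "norm (2 * z / (z\<^sup>2 - of_nat (Suc n) ^ 2)) \<le> 2 * norm z / (c * real (Suc n) ^ 2)"
        unfolding norm_divide norm_mult
        using norm_quadratic_lower_bound[of z "Suc n" 1, unfolded of_nat_1 mult_1_left] Imz c
        by (intro frac_le mult_pos_pos) (auto simp: c_def simp del: of_nat_Suc)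
      then show "norm (norm (2 * z / (z\<^sup>2 - of_nat (Suc n) ^ 2))) \<le> 2 * norm z / c * inverse (real (Suc n) ^ 2)"
        by (simp add: divide_inverse mult_ac)
    qed
  qed
  then have "((\<lambda>n. 2 * z / (z\<^sup>2 - of_nat n ^ 2)) has_sum (pi * cot (pi * z) - 1 / z)) {1..}"
    by (subst (asm) has_sum_Suc_iff)
  from has_sum_cmult_left[OF this, of "1 / of_nat m ^ (2 * N + 1)"]
  have *: "((\<lambda>n. 2 * z / (z\<^sup>2 - of_nat n ^ 2) * (1 / of_nat m ^ (2 * N + 1))) has_sum
      (pi * cot (pi * z) - 1 / z) * (1 / of_nat m ^ (2 * N + 1))) {1..}" .
  have "(pi * cot (pi * z) - 1 / z) * (1 / of_nat m ^ (2 * N + 1)) =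
      pi * cot (pi * (of_nat m * \<tau>)) / of_nat m ^ (2 * N + 1) - 1 / \<tau> * (1 / of_nat m ^ (2 * N + 2))"
    using m \<open>\<tau> \<noteq> 0\<close> by (simp add: z_def diff_divide_distrib mult_ac)
  moreover have "2 * z / (z\<^sup>2 - of_nat n ^ 2) * (1 / of_nat m ^ (2 * N + 1)) = ?f (m, n)" for n
    using m by (simp add: z_def)
  ultimately show "((\<lambda>n. ?f (m, n)) has_sum
     pi * cot (pi * (of_nat m * \<tau>)) / of_nat m ^ (2 * N + 1) - 1 / \<tau> * (1 / of_nat m ^ (2 * N + 2))) {1..}"
    using * by simp
next
  have "((\<lambda>m. pi * cot (pi * (of_nat m * \<tau>)) / of_nat m ^ (2 * N + 1) + (- (1 / \<tau>)) * (1 / of_nat m ^ (2 * N + 2)))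
      has_sum (- \<i> * pi * zeta_lambert (2 * N + 1) \<tau> + (- (1 / \<tau>)) * zeta (of_nat (2 * N + 2)))) {1..}"
    using N by (intro has_sum_add has_sum_cmult_right cot_series_has_sum zeta_has_sum \<tau>) auto
  then show "((\<lambda>m. pi * cot (pi * (of_nat m * \<tau>)) / of_nat m ^ (2 * N + 1) - 1 / \<tau> * (1 / of_nat m ^ (2 * N + 2)))
      has_sum (- \<i> * pi * zeta_lambert (2 * N + 1) \<tau> - zeta (of_nat (2 * N + 2)) / \<tau>)) {1..}"
    by (simp only: mult_minus_left add_uminus_conv_diff times_divide_eq_left mult_1_left)
qed

section \<open>Even zeta values\<close>

text \<open>Each partial fraction of the cotangent is a geometric series in
  \<open>(z / of_nat n)\<^sup>2\<close>. The resulting double family, summed by rows, gives the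
  cotangent, and summed by columns, the even zeta values.\<close>

lemma pi_cot_pi_power_series:
  fixes z :: complex
  assumes z: "z \<noteq> 0" "norm z < 1"
  shows "(\<lambda>k. (if k = 0 then 1 else if even k then - 2 * zeta (of_nat k) else 0) * z ^ k) sums
           (pi * z * cot (pi * z))"
proof -
  define f where "f = (\<lambda>n j::nat. (z / of_nat n) ^ (2 * j))"
  have zn: "z \<notin> \<int>"
    using z by (auto elim!: Ints_cases)
  have abs: "(\<lambda>(n, j). f n j) abs_summable_on ({1..} \<times> {1..})"
  proof (rule Infinite_Sum.abs_summable_on_comparison_test)
    have "(\<lambda>j. z ^ j) abs_summable_on {1..}"
      using z by (intro abs_summable_on_atLeast_1)
        (simp add: norm_mult norm_power summable_mult summable_geometric)
    then show "(\<lambda>(n, j). 1 / of_nat n ^ 2 * z ^ j) abs_summable_on ({1..} \<times> {1..})"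
      by (intro abs_summable_on_times abs_summable_inverse_power) auto
    fix x :: "nat \<times> nat" assume "x \<in> {1..} \<times> {1..}"
    then obtain n j where x: "x = (n, j)" "n \<ge> 1" "j \<ge> 1"
      by (cases x) auto
    \<comment> \<open>Lowering the exponent \<open>2 * j\<close> to \<open>j\<close> above and to
      \<open>2\<close> below the fraction bar separates the two indices, which leaves a product of
      convergent series.\<close>
    have "norm z ^ (2 * j) / real n ^ (2 * j) \<le> norm z ^ j / real n ^ 2"
      using x z by (intro frac_le power_decreasing power_increasing) auto
    then show "norm (case x of (n, j) \<Rightarrow> f n j) \<le> norm (case x of (n, j) \<Rightarrow> 1 / of_nat n ^ 2 * z ^ j)"
      by (simp add: x f_def norm_divide norm_mult norm_power power_divide)
  qed
  have row: "((\<lambda>j. f n j) has_sum (z\<^sup>2 / (of_nat n ^ 2 - z\<^sup>2))) {1..}" if n: "n \<in> {1..}" for n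
  proof -
    define w where "w = (z / of_nat n)\<^sup>2"
    have "norm (z / of_nat n) < 1"
      using z n by (simp add: norm_divide divide_less_eq)
    then have w: "norm w < 1"
      by (simp add: w_def norm_power power_less_one_iff)
    then have "w \<noteq> 1" by auto
    have "((\<lambda>j. w * w ^ j) has_sum (w * (1 / (1 - w)))) UNIV"
      using w by (intro has_sum_cmult_right norm_summable_imp_has_sum geometric_sums)
        (simp_all add: norm_power summable_geometric)
    then have "((\<lambda>j. f n (Suc j)) has_sum (w * (1 / (1 - w)))) UNIV"
      by (simp add: f_def w_def power_mult)
    moreover have "w * (1 / (1 - w)) = z\<^sup>2 / (of_nat n ^ 2 - z\<^sup>2)"
      using n \<open>w \<noteq> 1\<close> by (auto simp: w_def field_simps)
    ultimately show ?thesis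
      by (simp add: has_sum_Suc_iff)
  qed
  have column: "((\<lambda>n. f n j) has_sum (z ^ (2 * j) * zeta (of_nat (2 * j)))) {1..}" if "j \<in> {1..}" for j
    using has_sum_cmult_right[OF zeta_has_sum[of "2 * j"], of "z ^ (2 * j)"] that
    by (simp add: f_def power_divide)
  obtain S where S: "((\<lambda>(n, j). f n j) has_sum S) ({1..} \<times> {1..})"
    using abs_summable_summable[OF abs] by (auto simp: summable_on_def)
  have "((\<lambda>n. z\<^sup>2 / (of_nat n ^ 2 - z\<^sup>2)) has_sum S) {1..}"
    using has_sum_SigmaD[OF S] row by simp
  then have S1: "(\<lambda>n. z\<^sup>2 / (of_nat (Suc n) ^ 2 - z\<^sup>2)) sums S"
    by (subst (asm) has_sum_Suc_iff[symmetric]) (rule has_sum_imp_sums)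
  have "((\<lambda>(j, n). f n j) has_sum S) ({1..} \<times> {1..})"
    using S by (subst has_sum_swap) simp
  then have "((\<lambda>j. z ^ (2 * j) * zeta (of_nat (2 * j))) has_sum S) {1..}"
    using has_sum_SigmaD[of "\<lambda>(j, n). f n j" "{1..}" "\<lambda>_. {1..}" S] column by simp
  then have S2: "((\<lambda>k. z ^ k * zeta (of_nat k)) has_sum S) ((\<lambda>j. 2 * j) ` {1..})"
    by (subst has_sum_reindex) (auto simp: o_def inj_on_def)
  have "(\<lambda>n. - 2 * (z\<^sup>2 / (of_nat (Suc n) ^ 2 - z\<^sup>2))) sums (- 2 * S)"
    using S1 by (rule sums_mult)
  moreover have "- 2 * (z\<^sup>2 / (of_nat (Suc n) ^ 2 - z\<^sup>2)) = z * (2 * z / (z\<^sup>2 - of_nat (Suc n) ^ 2))" for n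
  proof -
    have "- 2 * (z\<^sup>2 / d) = z * (2 * z / - d)" for d
      by (simp add: power2_eq_square)
    from this[of "of_nat (Suc n) ^ 2 - z\<^sup>2"] show ?thesis
      by (simp only: minus_diff_eq)
  qed
  ultimately have "(\<lambda>n. z * (2 * z / (z\<^sup>2 - of_nat (Suc n) ^ 2))) sums (- 2 * S)"
    by simp
  with sums_mult[OF cot_pi_partial_fractions_sums[OF zn], of z]
  have "z * (pi * cot (pi * z) - 1 / z) = - 2 * S"
    by (rule sums_unique2)
  then have val: "pi * z * cot (pi * z) = 1 + - 2 * S"
    using z by (simp add: algebra_simps)
  have "((\<lambda>k. (if k = 0 then 1 else if even k then - 2 * zeta (of_nat k) else 0) * z ^ k) has_sum
      (1 + - 2 * S)) ({0} \<union> (\<lambda>j. 2 * j) ` {1..})"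
  proof (rule has_sum_Un_disjoint)
    show "((\<lambda>k. (if k = 0 then 1 else if even k then - 2 * zeta (of_nat k) else 0) * z ^ k) has_sum 1) {0}"
      by (simp add: has_sum_finite_iff)
    have "((\<lambda>k. - 2 * (z ^ k * zeta (of_nat k))) has_sum (- 2 * S)) ((\<lambda>j. 2 * j) ` {1..})"
      using S2 by (rule has_sum_cmult_right)
    then show "((\<lambda>k. (if k = 0 then 1 else if even k then - 2 * zeta (of_nat k) else 0) * z ^ k) has_sum - 2 * S)
        ((\<lambda>j. 2 * j) ` {1..})"
      by (rule has_sum_cong[THEN iffD1, rotated]) auto
  qed auto
  \<comment> \<open>The coefficients vanish at odd indices, so the index set extends to all
    naturals.\<close>
  then have "((\<lambda>k. (if k = 0 then 1 else if even k then - 2 * zeta (of_nat k) else 0) * z ^ k) has_sum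
      (1 + - 2 * S)) UNIV"
    by (rule has_sum_cong_neutral[THEN iffD1, rotated 3]) (auto elim!: evenE simp: image_iff)
  then show ?thesis
    unfolding val by (rule has_sum_imp_sums)
qed

text \<open>This is the generating function identity with \<open>c * X\<close> substituted for
  \<open>X\<close>: each coefficient of index \<open>n\<close> is scaled by \<open>c ^ n\<close>,
  which also carries the real identity over to complex \<open>c\<close>.\<close>

lemma bernoulli_fps_mult:
  "Abs_fps (\<lambda>m. of_real (bernoulli m / fact m) * c ^ m) * (fps_exp c - 1) = fps_const c * (fps_X :: complex fps)"
proof -
  \<comment> \<open>The quotient in \<open>bernoulli\<close> is exact because
    \<open>fps_exp 1 - 1\<close> has order 1 and hence divides \<open>fps_X\<close>.\<close>
  have sub: "subdegree (fps_exp 1 - 1 :: real fps) = 1"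
    by (rule subdegreeI) auto
  then have "fps_exp 1 - 1 \<noteq> (0 :: real fps)"
    by auto
  then have "(fps_exp 1 - 1 :: real fps) dvd fps_X"
    using sub by (subst fps_dvd_iff) auto
  then have *: "fps_X / (fps_exp 1 - 1) * (fps_exp 1 - 1) = (fps_X :: real fps)"
    by (rule dvd_div_mult_self)
  show ?thesis
  proof (rule fps_ext)
    fix n
    let ?b = "fps_X / (fps_exp 1 - 1) :: real fps" and ?e = "fps_exp 1 - 1 :: real fps"
    have "fps_nth (Abs_fps (\<lambda>m. of_real (bernoulli m / fact m) * c ^ m) * (fps_exp c - 1)) n =
        (\<Sum>i=0..n. of_real (fps_nth ?b i) * c ^ i * (of_real (fps_nth ?e (n - i)) * c ^ (n - i)))"
      unfolding fps_mult_nth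
      by (rule sum.cong) (auto simp: bernoulli_def)
    also have "\<dots> = of_real (\<Sum>i=0..n. fps_nth ?b i * fps_nth ?e (n - i)) * c ^ n"
      unfolding of_real_sum sum_distrib_right
      by (rule sum.cong) (auto simp: mult_ac simp flip: power_add)
    also have "(\<Sum>i=0..n. fps_nth ?b i * fps_nth ?e (n - i)) = fps_nth fps_X n"
      by (subst (2) *[symmetric]) (simp add: fps_mult_nth)
    finally show "fps_nth (Abs_fps (\<lambda>m. of_real (bernoulli m / fact m) * c ^ m) * (fps_exp c - 1)) n =
        fps_nth (fps_const c * fps_X) n"
      by (cases "n = 1") simp_all
  qed
qed

lemma has_fps_expansion_unique:
  fixes f g :: "complex \<Rightarrow> complex"
  assumes "f has_fps_expansion F" "eventually (\<lambda>z. f z = g z) (nhds 0)" "g has_fps_expansion G"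
  shows "F = G"
proof (rule eval_fps_eqD)
  show "fps_conv_radius F > 0" "fps_conv_radius G > 0"
    using assms by (auto simp: has_fps_expansion_def)
  have "eventually (\<lambda>z. eval_fps F z = f z) (nhds 0)" "eventually (\<lambda>z. eval_fps G z = g z) (nhds 0)"
    using assms by (auto simp: has_fps_expansion_def)
  with assms(2) show "eventually (\<lambda>z. eval_fps F z = eval_fps G z) (nhds 0)"
    by eventually_elim simp
qed

text \<open>With \<open>c = 2 * pi * \<i>\<close>, the function
  \<open>pi * z * cot (pi * z) - c / 2 * z\<close> equals \<open>c * z / (exp (c * z) - 1)\<close>
  near 0, which is the Bernoulli generating function at \<open>c * z\<close>. Comparing coefficients
  with the cotangent power series gives Euler's formula.\<close>

lemma zeta_even_bernoulli:
  "bernoulli 0 = 1"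
  "k \<ge> 1 \<Longrightarrow> zeta (of_nat (2 * k)) =
    (-1) ^ (k + 1) * of_real (bernoulli (2 * k)) * (2 * pi) ^ (2 * k) / (2 * fact (2 * k))"
proof -
  define c where "c = 2 * complex_of_real pi * \<i>"
  define F where "F = Abs_fps (\<lambda>k. if k = 0 then 1 else if even k then - 2 * zeta (of_nat k) else 0)"
  \<comment> \<open>The literal expression evaluates to 0 at \<open>z = 0\<close>; its analytic
    extension has the value 1 there.\<close>
  define g where "g = (\<lambda>z::complex. if z = 0 then 1 else pi * z * cot (pi * z))"
  define E where "E = Abs_fps (\<lambda>m. complex_of_real (bernoulli m / fact m) * c ^ m)"
  have "g has_fps_expansion F"
  proof (rule has_fps_expansionI)
    have "eventually (\<lambda>z. z \<in> ball 0 1) (nhds (0::complex))"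
      by (intro eventually_nhds_in_open) auto
    then show "\<forall>\<^sub>F u in nhds 0. (\<lambda>n. fps_nth F n * u ^ n) sums g u"
    proof eventually_elim
      case (elim z)
      show ?case
      proof (cases "z = 0")
        case True
        then show ?thesis
          using powser_sums_zero[of "fps_nth F"] by (simp add: g_def F_def)
      next
        case False
        then show ?thesis
          using pi_cot_pi_power_series[of z] elim by (simp add: g_def F_def)
      qed
    qed
  qed
  \<comment> \<open>Multiplying by \<open>exp (c * z) - 1\<close> avoids a quotient that is singular
    at 0; the factor is cancelled later among formal power series.\<close>
  then have "(\<lambda>z. (g z - c / 2 * z) * (exp (c * z) - 1)) has_fps_expansion
      (F - fps_const (c / 2) * fps_X) * (fps_exp c - 1)"
    by (intro fps_expansion_intros)
  moreover have "eventually (\<lambda>z. (g z - c / 2 * z) * (exp (c * z) - 1) = c * z) (nhds 0)"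
  proof -
    have "eventually (\<lambda>z. z \<in> ball 0 1) (nhds (0::complex))"
      by (intro eventually_nhds_in_open) auto
    then show ?thesis
    proof eventually_elim
      case (elim z)
      show ?case
      proof (cases "z = 0 \<or> exp (c * z) = 1")
        case True
        \<comment> \<open>The equation \<open>exp (c * z) = 1\<close> forces \<open>z\<close> to be
          an integer, and 0 is the only integer in the open unit ball.\<close>
        have "z = 0"
        proof (rule ccontr)
          assume "z \<noteq> 0"
          with True have "exp (c * z) = 1"
            by blast
          then obtain n :: int where n: "Re (c * z) = 0" "Im (c * z) = of_int (2 * n) * pi"
            unfolding exp_eq_1 by blast
          have cz: "Re (c * z) = - 2 * pi * Im z" "Im (c * z) = 2 * pi * Re z"
            by (simp_all add: c_def)
          have "Im z = 0" "Re z = of_int n"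
            using n unfolding cz by simp_all
          then have "z = of_int n"
            by (simp add: complex_eq_iff)
          with elim \<open>z \<noteq> 0\<close> show False
            by auto
        qed
        then show ?thesis by simp
      next
        case False
        then have "cot (pi * z) = - \<i> * (1 + 2 * (exp (c * z) / (1 - exp (c * z))))"
          using cot_pi_eq_exp[of z] by (simp add: c_def)
        then have "g z = c / 2 * z * - (1 + 2 * (exp (c * z) / (1 - exp (c * z))))"
          using False by (simp add: g_def) (simp add: c_def algebra_simps)
        then show ?thesis
          using False by (simp add: divide_simps) (simp add: algebra_simps)
      qed
    qed
  qed
  moreover have "(\<lambda>z. c * z) has_fps_expansion E * (fps_exp c - 1)"
    unfolding E_def bernoulli_fps_mult by (intro fps_expansion_intros)
  ultimately have "(F - fps_const (c / 2) * fps_X) * (fps_exp c - 1) = E * (fps_exp c - 1)"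
    by (rule has_fps_expansion_unique)
  moreover have "fps_exp c - 1 \<noteq> (0 :: complex fps)"
  proof
    assume "fps_exp c - 1 = 0"
    then have "fps_nth (fps_exp c - 1) 1 = 0" by simp
    then show False by (simp add: c_def)
  qed
  ultimately have FE: "F - fps_const (c / 2) * fps_X = E"
    by simp
  have "fps_nth E 0 = 1"
    by (simp flip: FE add: F_def)
  then have "complex_of_real (bernoulli 0) = 1"
    by (simp add: E_def)
  then show "bernoulli 0 = 1"
    by simp
  assume "k \<ge> 1"
  then have "fps_nth E (2 * k) = - 2 * zeta (of_nat (2 * k))"
    by (simp flip: FE add: F_def)
  then have "complex_of_real (bernoulli (2 * k) / fact (2 * k)) * c ^ (2 * k) = - 2 * zeta (of_nat (2 * k))"
    by (simp add: E_def)
  moreover have "c ^ (2 * k) = (-1) ^ k * (2 * pi) ^ (2 * k)"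
  proof -
    have c2: "c\<^sup>2 = (-1) * complex_of_real ((2 * pi)\<^sup>2)"
      by (simp add: c_def power_mult_distrib)
    have "c ^ (2 * k) = (-1) ^ k * complex_of_real ((2 * pi)\<^sup>2) ^ k"
      by (simp only: power_mult c2 power_mult_distrib)
    then show ?thesis
      by (simp add: power_mult)
  qed
  ultimately have "- 2 * zeta (of_nat (2 * k)) =
      complex_of_real (bernoulli (2 * k) / fact (2 * k)) * ((-1) ^ k * (2 * pi) ^ (2 * k))"
    by simp
  then have "zeta (of_nat (2 * k)) =
      - (complex_of_real (bernoulli (2 * k) / fact (2 * k)) * ((-1) ^ k * (2 * pi) ^ (2 * k))) / 2"
  proof -
    have "x = - y / 2" if "- 2 * x = y" for x y :: complex
      unfolding that[symmetric] by simp
    then show ?thesis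
      using \<open>- 2 * zeta (of_nat (2 * k)) = _\<close> by blast
  qed
  then show "zeta (of_nat (2 * k)) =
    (-1) ^ (k + 1) * of_real (bernoulli (2 * k)) * (2 * pi) ^ (2 * k) / (2 * fact (2 * k))"
    by (simp add: mult_ac)
qed

section \<open>Ramanujan's reflection formula\<close>

lemma has_sum_sum:
  fixes f :: "'i \<Rightarrow> 'a \<Rightarrow> 'b::{topological_comm_monoid_add, t2_space}"
  assumes "\<And>i. i \<in> I \<Longrightarrow> (f i has_sum S i) A"
  shows "((\<lambda>x. \<Sum>i\<in>I. f i x) has_sum (\<Sum>i\<in>I. S i)) A"
  using assms by (induction I rule: infinite_finite_induct) (auto intro!: has_sum_add)

text \<open>The factor \<open>x\<^sup>2 - y\<^sup>2\<close> divides
  \<open>x ^ (2 * N) - y ^ (2 * N)\<close>, so the mixed denominator disappears. In what remains the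
  variables are separated, and each summand of a double series becomes a product of single
  ones.\<close>

lemma reflection_telescoping:
  fixes x y :: complex
  assumes "x \<noteq> 0" "y \<noteq> 0" "x\<^sup>2 \<noteq> y\<^sup>2"
  shows "1 / (x\<^sup>2 - y\<^sup>2) / x ^ (2 * N) - 1 / (x\<^sup>2 - y\<^sup>2) / y ^ (2 * N) =
    - (\<Sum>j<N. 1 / x ^ (2 * (N - j)) * (1 / y ^ (2 * (j + 1))))"
proof -
  have "(x\<^sup>2) ^ N - (y\<^sup>2) ^ N = (x\<^sup>2 - y\<^sup>2) * (\<Sum>i<N. (y\<^sup>2) ^ (N - Suc i) * (x\<^sup>2) ^ i)"
    by (rule power_diff_sumr2)
  then have *: "(x ^ (2 * N) - y ^ (2 * N)) / (x\<^sup>2 - y\<^sup>2) = (\<Sum>i<N. (y\<^sup>2) ^ (N - Suc i) * (x\<^sup>2) ^ i)"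
    using assms by (simp add: power_mult)
  have "1 / (x\<^sup>2 - y\<^sup>2) / x ^ (2 * N) - 1 / (x\<^sup>2 - y\<^sup>2) / y ^ (2 * N) =
      - ((x ^ (2 * N) - y ^ (2 * N)) / (x\<^sup>2 - y\<^sup>2)) * (1 / (x ^ (2 * N) * y ^ (2 * N)))"
  proof -
    have "1 / d / a - 1 / d / b = - ((a - b) / d) * (1 / (a * b))" if "a \<noteq> 0" "b \<noteq> 0" for a b d :: complex
      using that by (cases "d = 0") (simp_all add: field_simps)
    then show ?thesis
      using assms by simp
  qed
  also have "\<dots> = - (\<Sum>i<N. (y\<^sup>2) ^ (N - Suc i) * (x\<^sup>2) ^ i * (1 / (x ^ (2 * N) * y ^ (2 * N))))"
    by (simp add: * sum_distrib_right sum_divide_distrib)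
  also have "(\<Sum>i<N. (y\<^sup>2) ^ (N - Suc i) * (x\<^sup>2) ^ i * (1 / (x ^ (2 * N) * y ^ (2 * N)))) =
      (\<Sum>j<N. 1 / x ^ (2 * (N - j)) * (1 / y ^ (2 * (j + 1))))"
  proof (rule sum.cong)
    fix i assume i: "i \<in> {..<N}"
    have "2 * N = 2 * i + 2 * (N - i)" "2 * N = 2 * (N - Suc i) + 2 * (i + 1)"
      using i by auto
    then have "x ^ (2 * N) = x ^ (2 * i) * x ^ (2 * (N - i))" "y ^ (2 * N) = y ^ (2 * (N - Suc i)) * y ^ (2 * (i + 1))"
      by (metis power_add)+
    then show "(y\<^sup>2) ^ (N - Suc i) * (x\<^sup>2) ^ i * (1 / (x ^ (2 * N) * y ^ (2 * N))) =
        1 / x ^ (2 * (N - i)) * (1 / y ^ (2 * (i + 1)))"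
      using assms by (simp flip: power_mult)
  qed simp
  finally show ?thesis .
qed

text \<open>Exchanging \<open>m\<close> and \<open>n\<close> in the double series at
  \<open>- 1 / \<tau>\<close> gives, up to powers of \<open>\<tau>\<close>, the same denominators as
  at \<open>\<tau>\<close>. The factor \<open>\<tau> ^ (2 * N)\<close> matches those powers, and
  \<open>reflection_telescoping\<close> with \<open>x = m * \<tau>\<close> and \<open>y = n\<close>
  leaves products of even zeta values.\<close>

lemma zeta_lambert_reflection_zeta:
  fixes \<tau> :: complex
  assumes \<tau>: "Im \<tau> > 0" and N: "N \<ge> 1"
  shows "- \<i> * pi * zeta_lambert (2 * N + 1) \<tau> - zeta (of_nat (2 * N + 2)) / \<tau> -
      \<tau> ^ (2 * N) * (- \<i> * pi * zeta_lambert (2 * N + 1) (- 1 / \<tau>) + \<tau> * zeta (of_nat (2 * N + 2))) =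
      - 2 * (\<Sum>j<N. \<tau> ^ (2 * j + 1) * (zeta (of_nat (2 * (N - j))) * zeta (of_nat (2 * (j + 1)))))"
    (is "?A - _ * ?B = _")
proof -
  define f where "f = (\<lambda>\<tau> (m, n). 2 * \<tau> / ((of_nat m * \<tau>)\<^sup>2 - of_nat n ^ 2) / of_nat m ^ (2 * N) :: complex)"
  have \<tau>0: "\<tau> \<noteq> 0" using \<tau> by auto
  have \<tau>': "Im (- 1 / \<tau>) > 0"
    using \<tau> \<tau>0 by (simp add: Im_divide')
  have f1: "(f \<tau> has_sum ?A) ({1..} \<times> {1..})"
    using cot_double_series_has_sum[OF \<tau> N] by (simp only: f_def)
  have "(f (- 1 / \<tau>) has_sum ?B) ({1..} \<times> {1..})"
    using cot_double_series_has_sum[OF \<tau>' N] \<tau>0 by (simp add: f_def mult_ac)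
  then have "((\<lambda>(m, n). f (- 1 / \<tau>) (n, m)) has_sum ?B) ({1..} \<times> {1..})"
    by (subst (asm) has_sum_swap)
  then have "((\<lambda>x. - (\<tau> ^ (2 * N)) * (case x of (m, n) \<Rightarrow> f (- 1 / \<tau>) (n, m))) has_sum (- (\<tau> ^ (2 * N)) * ?B)) ({1..} \<times> {1..})"
    by (rule has_sum_cmult_right)
  from has_sum_add[OF f1 this]
  have L: "((\<lambda>x. f \<tau> x + - (\<tau> ^ (2 * N)) * (case x of (m, n) \<Rightarrow> f (- 1 / \<tau>) (n, m))) has_sum
      (?A + - (\<tau> ^ (2 * N)) * ?B)) ({1..} \<times> {1..})" .
  have R: "((\<lambda>x. - 2 * (\<Sum>j<N. \<tau> ^ (2 * j + 1) *
      (case x of (m, n) \<Rightarrow> 1 / of_nat m ^ (2 * (N - j)) * (1 / of_nat n ^ (2 * (j + 1)))))) has_sum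
      (- 2 * (\<Sum>j<N. \<tau> ^ (2 * j + 1) * (zeta (of_nat (2 * (N - j))) * zeta (of_nat (2 * (j + 1)))))))
      ({1..} \<times> {1..})"
    by (intro has_sum_cmult_right has_sum_sum has_sum_times abs_summable_inverse_power zeta_has_sum) auto
  have "f \<tau> x + - (\<tau> ^ (2 * N)) * (case x of (m, n) \<Rightarrow> f (- 1 / \<tau>) (n, m)) =
      - 2 * (\<Sum>j<N. \<tau> ^ (2 * j + 1) *
      (case x of (m, n) \<Rightarrow> 1 / of_nat m ^ (2 * (N - j)) * (1 / of_nat n ^ (2 * (j + 1)))))"
    if x_in: "x \<in> {1..} \<times> {1..}" for x
  proof -
    obtain m n where x: "x = (m, n)" "m \<ge> 1" "n \<ge> 1"
      using x_in by auto
    define u where "u = of_nat m * \<tau>"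
    define v where "v = complex_of_nat n"
    have u: "u \<noteq> 0" "v \<noteq> 0"
      using x \<tau>0 by (auto simp: u_def v_def)
    have "u \<noteq> v" "u \<noteq> - v"
      using \<tau> x by (auto simp: u_def v_def complex_eq_iff)
    then have uv: "u\<^sup>2 \<noteq> v\<^sup>2"
      by (simp add: power2_eq_iff)
    \<comment> \<open>Eliminating \<open>m\<close> in favour of \<open>u / \<tau>\<close> turns both
      summands into powers of \<open>\<tau>\<close> times functions of \<open>u\<close> and
      \<open>v\<close>.\<close>
    have m: "complex_of_nat m = u / \<tau>"
      using \<tau>0 by (simp add: u_def)
    have a: "f \<tau> x = 2 * \<tau> ^ (2 * N + 1) * (1 / (u\<^sup>2 - v\<^sup>2) / u ^ (2 * N))"
      using \<tau>0 by (simp add: f_def x m v_def[symmetric] power_divide)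
    have "(v * (- 1 / \<tau>))\<^sup>2 - (u / \<tau>)\<^sup>2 = - (u\<^sup>2 - v\<^sup>2) / \<tau>\<^sup>2"
      by (simp add: power_mult_distrib power_divide diff_divide_distrib)
    then have "f (- 1 / \<tau>) (n, m) = 2 * \<tau> * (1 / (u\<^sup>2 - v\<^sup>2) / v ^ (2 * N))"
      using \<tau>0 uv u by (simp add: f_def m v_def[symmetric] field_simps power2_eq_square)
    then have b: "\<tau> ^ (2 * N) * f (- 1 / \<tau>) (n, m) = 2 * \<tau> ^ (2 * N + 1) * (1 / (u\<^sup>2 - v\<^sup>2) / v ^ (2 * N))"
      by simp
    have "f \<tau> x - \<tau> ^ (2 * N) * f (- 1 / \<tau>) (n, m) =
        - 2 * \<tau> ^ (2 * N + 1) * (\<Sum>j<N. 1 / u ^ (2 * (N - j)) * (1 / v ^ (2 * (j + 1))))"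
      unfolding a b right_diff_distrib[symmetric] reflection_telescoping[OF u uv] by simp
    also have "\<dots> = - 2 * (\<Sum>j<N. \<tau> ^ (2 * N + 1) * (1 / u ^ (2 * (N - j)) * (1 / v ^ (2 * (j + 1)))))"
      by (simp only: sum_distrib_left mult.assoc)
    also have "(\<Sum>j<N. \<tau> ^ (2 * N + 1) * (1 / u ^ (2 * (N - j)) * (1 / v ^ (2 * (j + 1))))) =
       (\<Sum>j<N. \<tau> ^ (2 * j + 1) * (1 / of_nat m ^ (2 * (N - j)) * (1 / of_nat n ^ (2 * (j + 1)))))"
    proof (rule sum.cong)
      fix j assume "j \<in> {..<N}"
      then have "2 * N + 1 = (2 * j + 1) + 2 * (N - j)"
        by auto
      then have "\<tau> ^ (2 * N + 1) = \<tau> ^ (2 * j + 1) * \<tau> ^ (2 * (N - j))"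
        by (metis power_add)
      then show "\<tau> ^ (2 * N + 1) * (1 / u ^ (2 * (N - j)) * (1 / v ^ (2 * (j + 1)))) =
          \<tau> ^ (2 * j + 1) * (1 / of_nat m ^ (2 * (N - j)) * (1 / of_nat n ^ (2 * (j + 1))))"
        using \<tau>0 by (simp add: u_def v_def power_mult_distrib)
    qed simp
    finally show ?thesis
      by (simp add: x)
  qed
  with L have "((\<lambda>x. - 2 * (\<Sum>j<N. \<tau> ^ (2 * j + 1) *
      (case x of (m, n) \<Rightarrow> 1 / of_nat m ^ (2 * (N - j)) * (1 / of_nat n ^ (2 * (j + 1)))))) has_sum
      (?A + - (\<tau> ^ (2 * N)) * ?B)) ({1..} \<times> {1..})"
    by (rule has_sum_cong[THEN iffD1, rotated])
  from has_sum_unique[OF this R] show ?thesis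
    by simp
qed

definition bernoulli_prod :: "nat \<Rightarrow> nat \<Rightarrow> complex" where
  "bernoulli_prod M j = of_real (bernoulli (2 * j) * bernoulli (2 * M - 2 * j) / (fact (2 * j) * fact (2 * M - 2 * j)))"

text \<open>Euler's formula turns the zeta products into Bernoulli products; the two separate terms
  with \<open>zeta (of_nat (2 * N + 2))\<close> become the end terms \<open>j = 0\<close> and
  \<open>j = N + 1\<close> of one sum.\<close>

lemma zeta_lambert_reflection:
  fixes \<tau> :: complex
  assumes \<tau>: "Im \<tau> > 0" and N: "N \<ge> 1"
  shows "zeta_lambert (2 * N + 1) \<tau> = \<tau> ^ (2 * N) * zeta_lambert (2 * N + 1) (- 1 / \<tau>) +
     (-1) ^ N * \<i> * (2 * pi) ^ (2 * N + 1) * (\<Sum>j=0..N+1. bernoulli_prod (N + 1) j * \<tau> powi (2 * int j - 1))"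
proof -
  \<comment> \<open>The entry \<open>- 1 / 2\<close> is the value of the continued zeta function at
    0. With it the Bernoulli formula also holds at \<open>j = 0\<close>, since
    \<open>bernoulli 0 = 1\<close>.\<close>
  define z where "z = (\<lambda>j. if j = 0 then - 1 / 2 else zeta (of_nat (2 * j)))"
  have \<tau>0: "\<tau> \<noteq> 0" using \<tau> by auto
  have z: "z j = (-1) ^ (j + 1) * of_real (bernoulli (2 * j)) * (2 * pi) ^ (2 * j) / (2 * fact (2 * j))" for j
    using zeta_even_bernoulli(1) zeta_even_bernoulli(2)[of j] by (simp add: z_def)
  have zz: "z j * z (N + 1 - j) = (-1) ^ (N + 1) * (2 * pi) ^ (2 * N + 2) / 4 * bernoulli_prod (N + 1) j"
    if j: "j \<in> {0..N+1}" for j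
  proof -
    have "(-1 :: complex) ^ (j + 1) * (-1) ^ (N + 1 - j + 1) = (-1) ^ (N + 1)"
      using j by (simp flip: power_add add: uminus_power_if)
    moreover have "complex_of_real (2 * pi) ^ (2 * j) * (2 * pi) ^ (2 * (N + 1 - j)) = (2 * pi) ^ (2 * N + 2)"
    proof -
      have "2 * j + 2 * (N + 1 - j) = 2 * N + 2"
        using j by auto
      then show ?thesis
        by (simp only: of_real_power power_add[symmetric])
    qed
    moreover have "2 * (N + 1) - 2 * j = 2 * (N + 1 - j)"
      by simp
    moreover have "z j * z (N + 1 - j) = ((-1) ^ (j + 1) * (-1) ^ (N + 1 - j + 1)) *
        (complex_of_real (2 * pi) ^ (2 * j) * (2 * pi) ^ (2 * (N + 1 - j))) / 4 *
        (of_real (bernoulli (2 * j)) * of_real (bernoulli (2 * (N + 1 - j))) /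
          (fact (2 * j) * fact (2 * (N + 1 - j))))"
      unfolding z by simp
    ultimately show ?thesis
      unfolding bernoulli_prod_def by (simp only: of_real_mult of_real_divide of_real_fact of_real_power of_real_minus of_real_1 of_real_numeral)
  qed
  have "(\<Sum>j=0..N+1. \<tau> powi (2 * int j - 1) * (z j * z (N + 1 - j))) =
      1 / \<tau> * (z 0 * z (N + 1)) + ((\<Sum>j=0..<N. \<tau> powi (2 * int (Suc j) - 1) * (z (Suc j) * z (N - j)))
       + \<tau> powi (2 * int (N + 1) - 1) * (z (N + 1) * z 0))"
  proof -
    have "(\<Sum>j=0..N+1. h j) = h 0 + ((\<Sum>j=0..<N. h (Suc j)) + h (N + 1))" for h :: "nat \<Rightarrow> complex"
      by (induction N) (simp_all add: add_ac)
    from this[of "\<lambda>j. \<tau> powi (2 * int j - 1) * (z j * z (N + 1 - j))"] show ?thesis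
      by (simp add: power_int_minus divide_inverse)
  qed
  also have "(\<Sum>j=0..<N. \<tau> powi (2 * int (Suc j) - 1) * (z (Suc j) * z (N - j))) =
      (\<Sum>j<N. \<tau> ^ (2 * j + 1) * (zeta (of_nat (2 * (N - j))) * zeta (of_nat (2 * (j + 1)))))"
    unfolding atLeast0LessThan
  proof (rule sum.cong)
    fix j assume "j \<in> {..<N}"
    have "2 * int (Suc j) - 1 = int (2 * j + 1)"
      by simp
    then have "\<tau> powi (2 * int (Suc j) - 1) = \<tau> ^ (2 * j + 1)"
      by (simp only: power_int_of_nat)
    then show "\<tau> powi (2 * int (Suc j) - 1) * (z (Suc j) * z (N - j)) =
      \<tau> ^ (2 * j + 1) * (zeta (of_nat (2 * (N - j))) * zeta (of_nat (2 * (j + 1))))"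
      using \<open>j \<in> {..<N}\<close> by (simp add: z_def mult.commute)
  qed simp
  also have "\<tau> powi (2 * int (N + 1) - 1) = \<tau> ^ (2 * N + 1)"
  proof -
    have "2 * int (N + 1) - 1 = int (2 * N + 1)"
      by simp
    then show ?thesis by (simp only: power_int_of_nat)
  qed
  finally have S: "(\<Sum>j<N. \<tau> ^ (2 * j + 1) * (zeta (of_nat (2 * (N - j))) * zeta (of_nat (2 * (j + 1))))) =
     (\<Sum>j=0..N+1. \<tau> powi (2 * int j - 1) * (z j * z (N + 1 - j)))
      - 1 / \<tau> * (z 0 * z (N + 1)) - \<tau> ^ (2 * N + 1) * (z (N + 1) * z 0)"
    by (simp add: algebra_simps)
  have "(\<Sum>j=0..N+1. \<tau> powi (2 * int j - 1) * (z j * z (N + 1 - j))) =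
     (\<Sum>j=0..N+1. (-1) ^ (N + 1) * (2 * pi) ^ (2 * N + 2) / 4 * (bernoulli_prod (N + 1) j * \<tau> powi (2 * int j - 1)))"
    by (rule sum.cong) (simp_all only: zz, simp add: mult_ac)
  also have "\<dots> = (-1) ^ (N + 1) * (2 * pi) ^ (2 * N + 2) / 4 * (\<Sum>j=0..N+1. bernoulli_prod (N + 1) j * \<tau> powi (2 * int j - 1))"
    by (simp only: sum_distrib_left)
  finally have S': "(\<Sum>j=0..N+1. \<tau> powi (2 * int j - 1) * (z j * z (N + 1 - j))) = \<dots>" .
  define T where "T = (\<Sum>j=0..N+1. bernoulli_prod (N + 1) j * \<tau> powi (2 * int j - 1))"
  define K K' Z where "K = zeta_lambert (2 * N + 1) \<tau>" and "K' = zeta_lambert (2 * N + 1) (- 1 / \<tau>)"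
    and "Z = zeta (of_nat (2 * N + 2))"
  have z1: "z (N + 1) = Z" "z 0 = - 1 / 2"
    by (simp_all add: z_def Z_def)
  \<comment> \<open>The terms with \<open>Z\<close> agree on both sides and cancel; the rest has the
    common factor \<open>- \<i> * pi\<close>.\<close>
  have "- \<i> * pi * K - Z / \<tau> - \<tau> ^ (2 * N) * (- \<i> * pi * K' + \<tau> * Z) =
     - 2 * ((-1) ^ (N + 1) * (2 * pi) ^ (2 * N + 2) / 4 * T - 1 / \<tau> * (- 1 / 2 * Z) - \<tau> ^ (2 * N + 1) * (Z * (- 1 / 2)))"
    using zeta_lambert_reflection_zeta[OF \<tau> N] unfolding S S' K_def K'_def Z_def T_def z1[unfolded Z_def] .
  then have "- \<i> * pi * (K - \<tau> ^ (2 * N) * K') = - \<i> * pi * ((-1) ^ N * \<i> * (2 * pi) ^ (2 * N + 1) * T)"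
    by (simp add: algebra_simps)
  then have "K - \<tau> ^ (2 * N) * K' = (-1) ^ N * \<i> * (2 * pi) ^ (2 * N + 1) * T"
    by (subst (asm) mult_cancel_left) auto
  then show ?thesis
    unfolding K_def K'_def T_def by (simp add: algebra_simps)
qed

section \<open>Periodicity and Hecke operators\<close>

lemma zeta_lambert_shift:
  "zeta_lambert s (\<tau> + of_int n) = zeta_lambert s \<tau>"
proof -
  have "exp (2 * pi * \<i> * (\<tau> + of_int n)) = exp (2 * pi * \<i> * \<tau>) * exp (2 * of_int n * pi * \<i>)"
    by (simp flip: exp_add add: algebra_simps)
  also have "exp (2 * of_int n * pi * \<i>) = (1::complex)"
    by (rule exp_integer_2pi) simp
  finally show ?thesis
    by (simp add: zeta_lambert_def)
qed

text \<open>Writing \<open>1 / (1 - x)\<close> as a finite geometric sum over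
  \<open>1 - x ^ p\<close> gives all summands the denominator \<open>1 - u ^ p\<close>.
  Orthogonality of the roots of unity then kills every power of \<open>u\<close> except the
  zeroth.\<close>

lemma sum_geometric_roots_of_unity:
  fixes u \<zeta> :: complex
  assumes root: "\<zeta> ^ p = 1" and prim: "\<And>j. 0 < j \<Longrightarrow> j < p \<Longrightarrow> \<zeta> ^ j \<noteq> 1"
    and u: "u ^ p \<noteq> 1" and p: "p > 0"
  shows "(\<Sum>b<p. 1 / (1 - u * \<zeta> ^ b)) = of_nat p / (1 - u ^ p)"
proof -
  have "1 / (1 - u * \<zeta> ^ b) = (\<Sum>j<p. (u * \<zeta> ^ b) ^ j) / (1 - u ^ p)" for b
  proof -
    have "(\<zeta> ^ b) ^ p = 1"
      using root by (metis mult.commute power_mult power_one)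
    then have "(u * \<zeta> ^ b) ^ p = u ^ p"
      by (simp add: power_mult_distrib)
    then have "(1 - u * \<zeta> ^ b) * (\<Sum>j<p. (u * \<zeta> ^ b) ^ j) = 1 - u ^ p"
      by (simp add: one_diff_power_eq[symmetric])
    with u show ?thesis
      by (auto simp: divide_simps mult.commute)
  qed
  then have "(\<Sum>b<p. 1 / (1 - u * \<zeta> ^ b)) = (\<Sum>b<p. \<Sum>j<p. (u * \<zeta> ^ b) ^ j) / (1 - u ^ p)"
    by (simp add: sum_divide_distrib)
  also have "(\<Sum>b<p. \<Sum>j<p. (u * \<zeta> ^ b) ^ j) = (\<Sum>j<p. u ^ j * (\<Sum>b<p. (\<zeta> ^ j) ^ b))"
    by (subst sum.swap) (simp add: sum_distrib_left power_mult_distrib mult.commute flip: power_mult)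
  also have "\<dots> = (\<Sum>j<p. if j = 0 then of_nat p else 0)"
  proof (rule sum.cong)
    fix j assume j: "j \<in> {..<p}"
    show "u ^ j * (\<Sum>b<p. (\<zeta> ^ j) ^ b) = (if j = 0 then of_nat p else 0)"
    proof (cases "j = 0")
      case False
      then have "\<zeta> ^ j \<noteq> 1"
        using prim j by auto
      moreover have "(\<zeta> ^ j) ^ p = 1"
        using root by (metis mult.commute power_mult power_one)
      ultimately show ?thesis
        using False by (simp add: geometric_sum)
    qed simp
  qed simp
  also have "\<dots> = of_nat p"
    using p by simp
  finally show ?thesis .
qed

text \<open>If \<open>p\<close> divides \<open>m\<close>, the shift by \<open>b\<close> becomes a
  full period and all \<open>p\<close> summands coincide. Otherwise the shifts run through all
  \<open>p\<close>-th roots of unity, and \<open>x / (1 - x) = 1 / (1 - x) - 1\<close> reduces the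
  sum to the preceding lemma.\<close>

lemma lambert_term_sum:
  fixes \<tau> :: complex
  assumes p: "prime p" and \<tau>: "Im \<tau> > 0" and m: "m \<ge> 1"
  defines "q \<equiv> exp (2 * pi * \<i> * \<tau>)" and "x \<equiv> \<lambda>b. exp (2 * pi * \<i> * ((\<tau> + of_nat b) / of_nat p))"
  shows "(\<Sum>b<p. x b ^ m / (1 - x b ^ m)) =
    of_nat p * (if p dvd m then q ^ (m div p) / (1 - q ^ (m div p)) else q ^ m / (1 - q ^ m))"
proof (cases "p dvd m")
  case True
  then obtain l where l: "m = p * l" by auto
  have p0: "p > 0" using p prime_gt_0_nat by auto
  have "x b ^ m = q ^ l" for b
  proof -
    have "x b ^ m = exp (2 * pi * \<i> * (of_nat l * \<tau>) + 2 * of_int (int (l * b)) * pi * \<i>)"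
      using p0 unfolding x_def exp_of_nat_mult[symmetric] l
      by (intro arg_cong[of _ _ exp]) (simp add: field_simps)
    also have "\<dots> = exp (of_nat l * (2 * pi * \<i> * \<tau>))"
      unfolding exp_add by (subst exp_integer_2pi) (simp_all add: mult_ac)
    also have "\<dots> = q ^ l"
      by (simp add: q_def exp_of_nat_mult)
    finally show ?thesis .
  qed
  then show ?thesis
    using True l p0 by simp
next
  case False
  have p0: "p > 0" using p prime_gt_0_nat by auto
  define u where "u = exp (2 * pi * \<i> * (of_nat m * \<tau> / of_nat p))"
  define \<zeta> where "\<zeta> = exp (2 * pi * \<i> * (of_nat m / of_nat p))"
  have xm: "x b ^ m = u * \<zeta> ^ b" for b
    unfolding x_def u_def \<zeta>_def exp_of_nat_mult[symmetric] exp_add[symmetric]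
    by (simp add: add_divide_distrib algebra_simps)
  have up: "u ^ p = q ^ m"
    using p0 unfolding u_def q_def exp_of_nat_mult[symmetric] by (simp add: mult_ac)
  have "norm q < 1"
    using \<tau> by (simp add: q_def)
  then have normlt: "norm (q ^ m) < 1"
    using m by (simp add: norm_power power_less_one_iff)
  then have qm: "q ^ m \<noteq> 1" by auto
  have \<zeta>p: "\<zeta> ^ p = 1"
  proof -
    have "\<zeta> ^ p = exp (2 * of_int (int m) * pi * \<i>)"
      using p0 unfolding \<zeta>_def exp_of_nat_mult[symmetric] by (simp add: mult_ac)
    also have "\<dots> = 1"
      by (rule exp_integer_2pi) simp
    finally show ?thesis .
  qed
  have \<zeta>j: "\<zeta> ^ j \<noteq> 1" if j: "0 < j" "j < p" for j
  proof
    assume "\<zeta> ^ j = 1"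
    then have "exp (2 * pi * \<i> * (of_nat (j * m) / of_nat p)) = 1"
      unfolding \<zeta>_def exp_of_nat_mult[symmetric] by (simp add: mult_ac)
    then obtain n :: int where "Im (2 * pi * \<i> * (of_nat (j * m) / of_nat p)) = of_int (2 * n) * pi"
      unfolding exp_eq_1 by blast
    then have "real (j * m) = of_int (n * int p)"
      using p0 by (simp add: field_simps)
    then have "int (j * m) = n * int p"
      by linarith
    \<comment> \<open>Primality enters here: \<open>p\<close> would have to divide \<open>j\<close>
      or \<open>m\<close>, but \<open>0 < j < p\<close> and \<open>p\<close> does not divide
      \<open>m\<close>.\<close>
    then have "p dvd j * m"
      by (metis dvd_triv_right int_dvd_int_iff)
    with p False j show False
      by (auto simp: prime_dvd_mult_iff dest: dvd_imp_le)
  qed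
  have xne: "x b ^ m \<noteq> 1" for b
  proof -
    have "(\<zeta> ^ b) ^ p = 1"
      using \<zeta>p by (metis mult.commute power_mult power_one)
    then have "(x b ^ m) ^ p = q ^ m"
      using up unfolding xm by (simp add: power_mult_distrib)
    with qm show ?thesis by auto
  qed
  have "(\<Sum>b<p. x b ^ m / (1 - x b ^ m)) = (\<Sum>b<p. 1 / (1 - u * \<zeta> ^ b) - 1)"
  proof (rule sum.cong)
    show "x b ^ m / (1 - x b ^ m) = 1 / (1 - u * \<zeta> ^ b) - 1" for b
      using xne[of b] unfolding xm by (simp add: field_simps)
  qed simp
  also have "\<dots> = of_nat p / (1 - q ^ m) - of_nat p"
    using sum_geometric_roots_of_unity[OF \<zeta>p \<zeta>j _ p0, of u] qm by (simp add: sum_subtractf up)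
  also have "\<dots> = of_nat p * (q ^ m / (1 - q ^ m))"
    using qm by (simp add: field_simps)
  finally show ?thesis
    using False by simp
qed

text \<open>By \<open>lambert_term_sum\<close> every \<open>m\<close> contributes \<open>p\<close>
  times its own Lambert term, and only multiples of \<open>p\<close> need a correction.\<close>

lemma lambert_hecke:
  fixes \<tau> :: complex
  assumes p: "prime p" and \<tau>: "Im \<tau> > 0" and s: "s \<ge> 2"
  shows "(\<Sum>b<p. lambert (exp (2 * pi * \<i> * ((\<tau> + of_nat b) / of_nat p))) (- of_nat s)) =
    of_nat p * lambert (exp (2 * pi * \<i> * \<tau>)) (- of_nat s) +
    of_nat p * (1 / of_nat p ^ s * (lambert (exp (2 * pi * \<i> * \<tau>)) (- of_nat s)
      - lambert (exp (2 * pi * \<i> * (of_nat p * \<tau>))) (- of_nat s)))"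
proof -
  define q where "q = exp (2 * pi * \<i> * \<tau>)"
  define x where "x = (\<lambda>b. exp (2 * pi * \<i> * ((\<tau> + of_nat b) / of_nat p)))"
  define A where "A = (\<lambda>q m. q ^ m / (1 - q ^ m) / of_nat m ^ s :: complex)"
  have p0: "p > 0" using p prime_gt_0_nat by auto
  have qp: "q ^ p = exp (2 * pi * \<i> * (of_nat p * \<tau>))"
    unfolding q_def exp_of_nat_mult[symmetric] by (simp add: mult_ac)
  have q: "norm q < 1"
    using \<tau> by (simp add: q_def)
  have xb: "norm (x b) < 1" for b
    using \<tau> p0 by (simp add: x_def)
  have nqp: "norm (q ^ p) < 1"
    using q p0 by (simp add: norm_power power_less_one_iff)
  have LA: "(A r has_sum lambert r (- of_nat s)) {1..}" if "norm r < 1" for r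
    using lambert_has_sum[OF that s] by (simp add: A_def)
  have L: "((\<lambda>m. \<Sum>b<p. A (x b) m) has_sum (\<Sum>b<p. lambert (x b) (- of_nat s))) {1..}"
    by (intro has_sum_sum LA xb)
  \<comment> \<open>The correction at \<open>m = p * l\<close> is the term at \<open>q\<close> minus
    the term at \<open>q ^ p\<close>, both of index \<open>l\<close>, divided by
    \<open>p ^ s\<close>. Summing over \<open>l\<close> and reindexing gives its total.\<close>
  have "((\<lambda>l. 1 / of_nat p ^ s * (A q l + - A (q ^ p) l)) has_sum
      1 / of_nat p ^ s * (lambert q (- of_nat s) + - lambert (q ^ p) (- of_nat s))) {1..}"
    by (intro has_sum_cmult_right has_sum_add has_sum_uminusI LA q nqp)
  also have "(\<lambda>l. 1 / of_nat p ^ s * (A q l + - A (q ^ p) l)) =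
      (\<lambda>m. q ^ (m div p) / (1 - q ^ (m div p)) / of_nat m ^ s - A q m) \<circ> (\<lambda>l. p * l)"
    using p0 by (auto simp: A_def o_def power_mult_distrib diff_divide_distrib mult_ac simp flip: power_mult)
  also have "(\<dots> has_sum 1 / of_nat p ^ s * (lambert q (- of_nat s) + - lambert (q ^ p) (- of_nat s))) {1..} \<longleftrightarrow>
      ((\<lambda>m. q ^ (m div p) / (1 - q ^ (m div p)) / of_nat m ^ s - A q m) has_sum
        1 / of_nat p ^ s * (lambert q (- of_nat s) + - lambert (q ^ p) (- of_nat s))) ((\<lambda>l. p * l) ` {1..})"
    using p0 by (subst has_sum_reindex) (auto simp: inj_on_def)
  also have "\<dots> \<longleftrightarrow> ((\<lambda>m. if p dvd m then q ^ (m div p) / (1 - q ^ (m div p)) / of_nat m ^ s - A q m else 0) has_sum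
        1 / of_nat p ^ s * (lambert q (- of_nat s) + - lambert (q ^ p) (- of_nat s))) {1..}"
    using p0 by (intro has_sum_cong_neutral) (auto simp: image_iff elim!: dvdE)
  finally have B: "((\<lambda>m. if p dvd m then q ^ (m div p) / (1 - q ^ (m div p)) / of_nat m ^ s - A q m else 0) has_sum
        1 / of_nat p ^ s * (lambert q (- of_nat s) + - lambert (q ^ p) (- of_nat s))) {1..}" .
  have R: "((\<lambda>m. of_nat p * A q m +
      of_nat p * (if p dvd m then q ^ (m div p) / (1 - q ^ (m div p)) / of_nat m ^ s - A q m else 0)) has_sum
      (of_nat p * lambert q (- of_nat s) +
       of_nat p * (1 / of_nat p ^ s * (lambert q (- of_nat s) + - lambert (q ^ p) (- of_nat s))))) {1..}"
    by (intro has_sum_add has_sum_cmult_right B LA q)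
  have "(\<Sum>b<p. A (x b) m) = of_nat p * A q m +
      of_nat p * (if p dvd m then q ^ (m div p) / (1 - q ^ (m div p)) / of_nat m ^ s - A q m else 0)"
    if "m \<in> {1..}" for m
  proof -
    have "(\<Sum>b<p. A (x b) m) = (\<Sum>b<p. x b ^ m / (1 - x b ^ m)) / of_nat m ^ s"
      by (simp add: A_def sum_divide_distrib)
    also have "(\<Sum>b<p. x b ^ m / (1 - x b ^ m)) =
      of_nat p * (if p dvd m then q ^ (m div p) / (1 - q ^ (m div p)) else q ^ m / (1 - q ^ m))"
      using lambert_term_sum[OF p \<tau>, of m] that by (simp add: x_def q_def)
    finally show ?thesis
      by (simp add: A_def algebra_simps)
  qed
  with R have "((\<lambda>m. \<Sum>b<p. A (x b) m) has_sum
      (of_nat p * lambert q (- of_nat s) +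
       of_nat p * (1 / of_nat p ^ s * (lambert q (- of_nat s) + - lambert (q ^ p) (- of_nat s))))) {1..}"
    using has_sum_cong by (metis (no_types, lifting))
  from has_sum_unique[OF L this] show ?thesis
    unfolding qp by (simp only: x_def q_def add_uminus_conv_diff)
qed

text \<open>The zeta constant obeys the relation of the Lambert part because
  \<open>p = (p + 1 / p ^ s) - 1 / p ^ s\<close>. With \<open>Suc s\<close> as the parameter, one
  factor \<open>p\<close> cancels and the eigenvalue is \<open>p + 1 / p ^ s\<close>.\<close>

lemma zeta_lambert_hecke:
  fixes \<tau> :: complex
  assumes p: "prime p" and \<tau>: "Im \<tau> > 0" and s: "s \<ge> 1"
  shows "(\<Sum>b<p. zeta_lambert (Suc s) ((\<tau> + of_nat b) / of_nat p)) =
    (of_nat p + 1 / of_nat p ^ s) * zeta_lambert (Suc s) \<tau> - zeta_lambert (Suc s) (of_nat p * \<tau>) / of_nat p ^ s"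
proof -
  have Suc_s: "Suc s \<ge> 2" using s by simp
  have p0: "of_nat p \<noteq> (0::complex)" using p prime_gt_0_nat by auto
  have *: "of_nat p * z + 2 * (of_nat p * L + of_nat p * (1 / of_nat p ^ Suc s * (L - L'))) =
      (of_nat p + 1 / of_nat p ^ s) * (z + 2 * L) - (z + 2 * L') / of_nat p ^ s" for z L L' :: complex
    using p0 by (simp add: field_simps)
  have "(\<Sum>b<p. zeta_lambert (Suc s) ((\<tau> + of_nat b) / of_nat p)) =
     of_nat p * zeta (of_nat (Suc s)) + 2 * (\<Sum>b<p. lambert (exp (2 * pi * \<i> * ((\<tau> + of_nat b) / of_nat p))) (- of_nat (Suc s)))"
    unfolding zeta_lambert_def by (simp add: sum.distrib sum_distrib_left del: of_nat_Suc)
  also have "\<dots> = (of_nat p + 1 / of_nat p ^ s) * zeta_lambert (Suc s) \<tau> - zeta_lambert (Suc s) (of_nat p * \<tau>) / of_nat p ^ s"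
    unfolding lambert_hecke[OF p \<tau> Suc_s] zeta_lambert_def by (rule *)
  finally show ?thesis .
qed

section \<open>Specialization to the exponent \<open>4 * k + 1\<close>\<close>

definition refl_sum :: "nat \<Rightarrow> complex \<Rightarrow> complex" where
  "refl_sum k \<tau> = (\<Sum>j=0..2*k+1. bernoulli_prod (2 * k + 1) j * \<tau> powi (2 * int j - 1))"

text \<open>For \<open>N = 2 * k\<close> the sign \<open>(-1) ^ N\<close> is 1. Periodicity is built
  in: \<open>\<sigma>\<close> is any translate of the reflected point by an integer, and
  \<open>c\<close> is the evaluated automorphy factor.\<close>

lemma zeta_lambert_reflection_even:
  assumes "Im \<tau> > 0" "k \<ge> 1" "- 1 / \<tau> = \<sigma> + of_int n" "\<tau> ^ (4 * k) = c"
  shows "zeta_lambert (4 * k + 1) \<tau> =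
    c * zeta_lambert (4 * k + 1) \<sigma> + \<i> * (2 * pi) ^ (4 * k + 1) * refl_sum k \<tau>"
proof -
  have "2 * (2 * k) + 1 = 4 * k + 1" "2 * (2 * k) = 4 * k"
    by simp_all
  then show ?thesis
    using zeta_lambert_reflection[OF assms(1), of "2 * k"] assms(2)
    unfolding assms(3) zeta_lambert_shift refl_sum_def assms(4)[symmetric] by simp
qed

lemma one_plus_i_power4: "(1 + \<i>) ^ (4 * k) = (-4) ^ k" "(\<i> - 1) ^ (4 * k) = (-4) ^ k"
proof -
  have "(1 + \<i>) ^ 4 = -4" "(\<i> - 1) ^ 4 = -4"
    by (simp_all add: eval_nat_numeral algebra_simps)
  then show "(1 + \<i>) ^ (4 * k) = (-4) ^ k" "(\<i> - 1) ^ (4 * k) = (-4) ^ k"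
    by (simp_all add: power_mult)
qed

lemma i_power4: "\<i> ^ (4 * k) = 1"
  by (simp add: power_mult)

text \<open>This and \<open>coeff_a_bracket\<close> are named separately because each is the
  coefficient of \<open>Z \<i>\<close> in one Hecke relation: this one for the prime 2, the other
  for the prime 5.\<close>

definition coeff_a_numerator :: "nat \<Rightarrow> real" where
  "coeff_a_numerator k = 2 ^ (4 * k + 1) - (-1) ^ k * 2 ^ (2 * k) + 1"

definition coeff_a_bracket :: "nat \<Rightarrow> real" where
  "coeff_a_bracket k = 5 ^ (4 * k + 1) - 2 * 5 ^ (2 * k) * cos (4 * real k * arctan 2) + 1"

text \<open>The polar form of \<open>1 + 2 * \<i>\<close> has radius \<open>sqrt 5\<close> and
  argument \<open>arctan 2\<close>, and the two powers are conjugate. This is where the cosine in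
  \<open>coeff_a\<close> comes from.\<close>

lemma one_plus_2i_power4_sum:
  "(1 + 2 * \<i>) ^ (4 * k) + (1 - 2 * \<i>) ^ (4 * k) = of_real (2 * 5 ^ (2 * k) * cos (4 * real k * arctan 2))"
proof -
  have "1 + 2 * \<i> = of_real (sqrt 5) * cis (arctan 2)"
    by (simp add: complex_eq_iff cos_arctan sin_arctan)
  then have "(1 + 2 * \<i>) ^ (4 * k) = of_real (sqrt 5 ^ (4 * k)) * cis (real (4 * k) * arctan 2)"
    by (simp add: power_mult_distrib Complex.DeMoivre)
  also have "sqrt 5 ^ (4 * k) = 5 ^ (2 * k)"
    using power_mult[of "sqrt 5" 2 "2 * k"] by simp
  finally have *: "(1 + 2 * \<i>) ^ (4 * k) = of_real (5 ^ (2 * k)) * cis (real (4 * k) * arctan 2)" .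
  have "(1 - 2 * \<i>) ^ (4 * k) = cnj ((1 + 2 * \<i>) ^ (4 * k))"
    by (simp add: complex_cnj_power)
  then have "(1 + 2 * \<i>) ^ (4 * k) + (1 - 2 * \<i>) ^ (4 * k) = of_real (2 * Re ((1 + 2 * \<i>) ^ (4 * k)))"
    by (simp only: complex_add_cnj)
  then show ?thesis
    unfolding * by simp
qed

section \<open>The Hecke relations at the imaginary unit\<close>

text \<open>The point \<open>\<i> / 2\<close> reflects to \<open>2 * \<i>\<close>, which also occurs
  in the Hecke relation itself; hence the factor 2. The point \<open>(\<i> - 1) / 2\<close> reflects
  to \<open>\<i> + 1\<close>, a translate of \<open>\<i>\<close>.\<close>

lemma hecke_relation_2:
  assumes k: "k \<ge> 1"
  shows "2 * zeta_lambert (4 * k + 1) (2 * \<i>) =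
    of_real (coeff_a_numerator k) * zeta_lambert (4 * k + 1) \<i> -
    2 ^ (4 * k) * (\<i> * (2 * pi) ^ (4 * k + 1) * (refl_sum k (\<i> / 2) + refl_sum k ((\<i> - 1) / 2)))"
proof -
  let ?Z = "zeta_lambert (4 * k + 1)" and ?C = "\<i> * (2 * pi) ^ (4 * k + 1)"
  have "(\<Sum>b<2. ?Z ((\<i> + of_nat b) / of_nat 2)) = (of_nat 2 + 1 / of_nat 2 ^ (4 * k)) * ?Z \<i> - ?Z (of_nat 2 * \<i>) / of_nat 2 ^ (4 * k)"
    using zeta_lambert_hecke[of 2 \<i> "4 * k"] k by simp
  then have 1: "?Z (\<i> / 2) + ?Z ((\<i> + 1) / 2) = (2 + 1 / 2 ^ (4 * k)) * ?Z \<i> - ?Z (2 * \<i>) / 2 ^ (4 * k)"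
    by (simp add: eval_nat_numeral)
  \<comment> \<open>Both representatives reflect to translates of \<open>\<i>\<close>;
    \<open>(\<i> - 1) / 2 = \<i> * (1 + \<i>) / 2\<close> is the one that yields the powers of
    \<open>1 + \<i>\<close> in \<open>coeff_c\<close>.\<close>
  have "(\<i> + 1) / 2 = (\<i> - 1) / 2 + of_int 1"
    by (simp add: complex_eq_iff)
  then have 2: "?Z ((\<i> + 1) / 2) = ?Z ((\<i> - 1) / 2)"
    by (simp only: zeta_lambert_shift)
  have 3: "?Z (\<i> / 2) = 1 / 2 ^ (4 * k) * ?Z (2 * \<i>) + ?C * refl_sum k (\<i> / 2)"
    by (rule zeta_lambert_reflection_even[where n = 0])
      (use k in \<open>simp_all add: power_divide i_power4 complex_eq_iff\<close>)
  have 4: "?Z ((\<i> - 1) / 2) = (-4) ^ k / 2 ^ (4 * k) * ?Z \<i> + ?C * refl_sum k ((\<i> - 1) / 2)"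
    by (rule zeta_lambert_reflection_even[where n = 1])
      (use k in \<open>simp_all add: power_divide one_plus_i_power4 complex_eq_iff Re_divide Im_divide\<close>)
  have pow: "(-4 :: complex) ^ k = (-1) ^ k * 2 ^ (2 * k)"
    by (simp add: power_mult flip: power_mult_distrib)
  have num: "complex_of_real (coeff_a_numerator k) = 2 ^ (4 * k) * 2 - (-4) ^ k + 1"
    unfolding pow by (simp add: coeff_a_numerator_def)
  have gen: "2 * z2 = (P * 2 - c + 1) * z - P * (C * (r1 + r2))"
    if "1 / P * z2 + C * r1 + (c / P * z + C * r2) = (2 + 1 / P) * z - z2 / P" "P \<noteq> 0"
    for P z2 C r1 r2 c z :: complex
  proof -
    have "P * (1 / P * z2 + C * r1 + (c / P * z + C * r2)) = P * ((2 + 1 / P) * z - z2 / P)"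
      using that(1) by simp
    with that(2) have "z2 + P * (C * r1) + (c * z + P * (C * r2)) = P * 2 * z + z - z2"
      by (simp add: algebra_simps)
    then show ?thesis
      by (simp add: algebra_simps)
  qed
  show ?thesis
    unfolding num by (rule gen) (use 1[unfolded 2 3 4] in simp_all)
qed

text \<open>Modulo 1 the points are \<open>(\<i> + n) / 5\<close> with \<open>n\<close> from -2 to
  2. Reflection sends \<open>n = 0\<close> to \<open>5 * \<i>\<close>, both \<open>n = 1\<close> and
  \<open>n = -1\<close> to translates of \<open>(1 + 5 * \<i>) / 2\<close>, and \<open>n = 2\<close>
  and \<open>n = -2\<close> to translates of \<open>\<i>\<close>.\<close>

lemma hecke_relation_5:
  assumes k: "k \<ge> 1"
  shows "2 * zeta_lambert (4 * k + 1) (5 * \<i>) + 2 * (-4) ^ k * zeta_lambert (4 * k + 1) ((1 + 5 * \<i>) / 2) +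
    5 ^ (4 * k) * (\<i> * (2 * pi) ^ (4 * k + 1) * (refl_sum k (\<i> / 5) + refl_sum k ((\<i> + 1) / 5) + refl_sum k ((\<i> - 1) / 5)
      + refl_sum k ((\<i> + 2) / 5) + refl_sum k ((\<i> - 2) / 5))) =
    of_real (coeff_a_bracket k) * zeta_lambert (4 * k + 1) \<i>"
proof -
  let ?Z = "zeta_lambert (4 * k + 1)" and ?C = "\<i> * (2 * pi) ^ (4 * k + 1)"
  have "prime (5::nat)"
    by simp
  then have "(\<Sum>b<5. ?Z ((\<i> + of_nat b) / of_nat 5)) = (of_nat 5 + 1 / of_nat 5 ^ (4 * k)) * ?Z \<i> - ?Z (of_nat 5 * \<i>) / of_nat 5 ^ (4 * k)"
    using zeta_lambert_hecke[of 5 \<i> "4 * k"] k by simp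
  then have 1: "?Z (\<i> / 5) + ?Z ((\<i> + 1) / 5) + ?Z ((\<i> + 2) / 5) + ?Z ((\<i> + 3) / 5) + ?Z ((\<i> + 4) / 5) =
      (5 + 1 / 5 ^ (4 * k)) * ?Z \<i> - ?Z (5 * \<i>) / 5 ^ (4 * k)"
    by (simp add: eval_nat_numeral)
  have "(\<i> + 3) / 5 = (\<i> - 2) / 5 + of_int 1" "(\<i> + 4) / 5 = (\<i> - 1) / 5 + of_int 1"
    by (simp_all add: complex_eq_iff)
  then have 2: "?Z ((\<i> + 3) / 5) = ?Z ((\<i> - 2) / 5)" "?Z ((\<i> + 4) / 5) = ?Z ((\<i> - 1) / 5)"
    by (simp_all only: zeta_lambert_shift)
  have 3: "?Z (\<i> / 5) = 1 / 5 ^ (4 * k) * ?Z (5 * \<i>) + ?C * refl_sum k (\<i> / 5)"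
    by (rule zeta_lambert_reflection_even[where n = 0])
      (use k in \<open>simp_all add: power_divide i_power4 complex_eq_iff\<close>)
  have 4: "?Z ((\<i> + 1) / 5) = (-4) ^ k / 5 ^ (4 * k) * ?Z ((1 + 5 * \<i>) / 2) + ?C * refl_sum k ((\<i> + 1) / 5)"
    by (rule zeta_lambert_reflection_even[where n = "-3"])
      (use k one_plus_i_power4(1)[of k] in \<open>simp_all add: power_divide add.commute complex_eq_iff Re_divide Im_divide\<close>)
  have 5: "?Z ((\<i> - 1) / 5) = (-4) ^ k / 5 ^ (4 * k) * ?Z ((1 + 5 * \<i>) / 2) + ?C * refl_sum k ((\<i> - 1) / 5)"
    by (rule zeta_lambert_reflection_even[where n = 2])
      (use k in \<open>simp_all add: power_divide one_plus_i_power4 complex_eq_iff Re_divide Im_divide\<close>)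
  \<comment> \<open>The factor \<open>\<i>\<close> disappears in a \<open>4 * k\<close>-th power, so
    the two automorphy factors are conjugate and add up to the cosine term.\<close>
  have rot: "\<i> + 2 = \<i> * (1 - 2 * \<i>)" "\<i> - 2 = \<i> * (1 + 2 * \<i>)"
    by (simp_all add: complex_eq_iff)
  have 6: "?Z ((\<i> + 2) / 5) = (1 - 2 * \<i>) ^ (4 * k) / 5 ^ (4 * k) * ?Z \<i> + ?C * refl_sum k ((\<i> + 2) / 5)"
  proof (rule zeta_lambert_reflection_even[where n = "-2"])
    show "((\<i> + 2) / 5) ^ (4 * k) = (1 - 2 * \<i>) ^ (4 * k) / 5 ^ (4 * k)"
      unfolding rot by (simp add: power_divide power_mult_distrib i_power4)
  qed (use k in \<open>simp_all add: complex_eq_iff Re_divide Im_divide\<close>)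
  have 7: "?Z ((\<i> - 2) / 5) = (1 + 2 * \<i>) ^ (4 * k) / 5 ^ (4 * k) * ?Z \<i> + ?C * refl_sum k ((\<i> - 2) / 5)"
  proof (rule zeta_lambert_reflection_even[where n = 2])
    show "((\<i> - 2) / 5) ^ (4 * k) = (1 + 2 * \<i>) ^ (4 * k) / 5 ^ (4 * k)"
      unfolding rot by (simp add: power_divide power_mult_distrib i_power4)
  qed (use k in \<open>simp_all add: complex_eq_iff Re_divide Im_divide\<close>)
  have bracket: "complex_of_real (coeff_a_bracket k) =
      5 ^ (4 * k) * 5 - ((1 + 2 * \<i>) ^ (4 * k) + (1 - 2 * \<i>) ^ (4 * k)) + 1"
    unfolding one_plus_2i_power4_sum by (simp add: coeff_a_bracket_def)
  have gen: "2 * z5 + 2 * c * zh + P * (C * (r0 + r1 + r2 + r3 + r4)) = (P * 5 - (x + y) + 1) * z"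
    if "1 / P * z5 + C * r0 + (c / P * zh + C * r1) + (y / P * z + C * r3) + (x / P * z + C * r4)
        + (c / P * zh + C * r2) = (5 + 1 / P) * z - z5 / P" "P \<noteq> 0"
    for P z5 zh C r0 r1 r2 r3 r4 x y c z :: complex
  proof -
    have "P * (1 / P * z5 + C * r0 + (c / P * zh + C * r1) + (y / P * z + C * r3) + (x / P * z + C * r4)
        + (c / P * zh + C * r2)) = P * ((5 + 1 / P) * z - z5 / P)"
      using that(1) by simp
    with that(2) have "z5 + P * (C * r0) + (c * zh + P * (C * r1)) + (y * z + P * (C * r3)) + (x * z + P * (C * r4))
        + (c * zh + P * (C * r2)) = P * 5 * z + z - z5"
      by (simp add: algebra_simps)
    then show ?thesis
      by (simp add: algebra_simps)
  qed
  show ?thesis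
    unfolding bracket by (rule gen) (use 1[unfolded 2 3 4 5 6 7] in simp_all)
qed

text \<open>A growth comparison, needed for \<open>coeff_b k \<noteq> 0\<close>: with
  \<open>X = 4 ^ k\<close> and \<open>Y = 25 ^ k\<close> the left side is at most
  \<open>4 * X ^ 3\<close>, hence at most \<open>X ^ 4\<close> and \<open>Y\<^sup>2\<close>, while
  the right side is at least \<open>5 * Y\<^sup>2 - 2 * Y + 1\<close>.\<close>

lemma coeff_a_numerator_less_bracket:
  "coeff_a_numerator k * (1 + 4 ^ k) < coeff_a_bracket k" if "k \<ge> 1"
proof -
  define X Y :: real where "X = 4 ^ k" and "Y = 25 ^ k"
  have pows: "2 ^ (4 * k) = X ^ 2" "2 ^ (2 * k) = X" "5 ^ (4 * k) = Y ^ 2" "5 ^ (2 * k) = Y"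
  proof -
    show *: "2 ^ (2 * k) = X" "5 ^ (2 * k) = Y"
      by (simp_all add: X_def Y_def power_mult)
    show "2 ^ (4 * k) = X ^ 2" "5 ^ (4 * k) = Y ^ 2"
      by (simp_all flip: * power_mult)
  qed
  have X: "X \<ge> 4"
    using that power_increasing[of 1 k "4::real"] by (simp add: X_def)
  have YX: "X\<^sup>2 \<le> Y"
  proof -
    have "X\<^sup>2 = 4 ^ (2 * k)"
      unfolding X_def by (metis power_mult mult.commute)
    then show ?thesis
      by (simp add: Y_def power_mult power_mono)
  qed
  have "(-1) ^ k * X \<ge> - X"
    using X by (cases "even k") auto
  then have "coeff_a_numerator k \<le> 2 * X ^ 2 + X + 1"
    by (simp add: coeff_a_numerator_def pows)
  then have "coeff_a_numerator k * (1 + X) \<le> (2 * X ^ 2 + X + 1) * (1 + X)"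
    using X by (intro mult_right_mono) auto
  also have "\<dots> \<le> 4 * X ^ 3"
  proof -
    have "4 * X \<le> X * X" "4 * (X * X) \<le> X * (X * X)"
      using X by (auto intro!: mult_right_mono)
    moreover have "(2 * X ^ 2 + X + 1) * (1 + X) = 2 * (X * (X * X)) + 3 * (X * X) + 2 * X + 1"
      by (simp add: power2_eq_square algebra_simps)
    moreover have "4 * X ^ 3 = 4 * (X * (X * X))"
      by (simp add: power3_eq_cube)
    ultimately show ?thesis
      using X by linarith
  qed
  also have "\<dots> \<le> (X\<^sup>2)\<^sup>2"
  proof -
    have "4 * X ^ 3 \<le> X * X ^ 3"
      using X by (intro mult_right_mono) auto
    also have "\<dots> = (X\<^sup>2)\<^sup>2"
      by (simp add: eval_nat_numeral)
    finally show ?thesis .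
  qed
  also have "\<dots> \<le> Y\<^sup>2"
    using YX by (intro power_mono) auto
  also have "\<dots> < 5 * Y\<^sup>2 - 2 * Y + 1"
  proof -
    have "Y \<ge> 1" by (simp add: Y_def)
    then have "Y * 1 \<le> Y * Y"
      by (intro mult_left_mono) auto
    then show ?thesis
      using \<open>Y \<ge> 1\<close> unfolding power2_eq_square by linarith
  qed
  also have "\<dots> \<le> coeff_a_bracket k"
  proof -
    have "Y * cos (4 * real k * arctan 2) \<le> Y * 1"
      by (intro mult_left_mono) (auto simp: Y_def)
    then show ?thesis
      by (simp add: coeff_a_bracket_def pows)
  qed
  finally show ?thesis
    by (simp add: X_def)
qed

section \<open>The coefficients\<close>

lemma int_atLeastAtMost_m2_2: "{-2..2::int} = {-2, -1, 0, 1, 2}"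
  by auto

lemma coeff_a_eq: "coeff_a k = coeff_a_numerator k / (2 ^ (4 * k) * coeff_a_bracket k)"
  by (simp add: coeff_a_def coeff_a_numerator_def coeff_a_bracket_def)

lemma coeff_a_numerator_nonneg: "coeff_a_numerator k \<ge> 0"
proof -
  have "(-1) ^ k * (2::real) ^ (2 * k) \<le> 2 ^ (2 * k)"
    by (cases "even k") auto
  also have "\<dots> \<le> 2 ^ (4 * k + 1)"
    by (rule power_increasing) auto
  finally show ?thesis
    by (simp add: coeff_a_numerator_def)
qed

lemma coeff_a_bracket_pos: "k \<ge> 1 \<Longrightarrow> coeff_a_bracket k > 0"
  using coeff_a_numerator_less_bracket[of k] mult_nonneg_nonneg[OF coeff_a_numerator_nonneg, of "1 + 4 ^ k" k]
  by simp

text \<open>The five-term sum contains the same cosine term as \<open>coeff_a_bracket\<close>. Since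
  \<open>coeff_a\<close> times the bracket is the numerator over \<open>2 ^ (4 * k)\<close>, the
  large terms cancel. The form obtained is the one in which the coefficient of the zeta value arises
  in the elimination.\<close>

lemma coeff_b_eq:
  assumes k: "k \<ge> 1"
  shows "coeff_b k = 1 / 2 ^ (4 * k) - of_real (coeff_a k) * (1 + (-4) ^ k)"
proof -
  define Q where "Q = complex_of_real (2 * 5 ^ (2 * k) * cos (4 * real k * arctan 2))"
  have D: "coeff_a_bracket k \<noteq> 0"
    using coeff_a_bracket_pos[OF k] by simp
  have conj: "(1 - \<i>) ^ (4 * k) = (-4) ^ k"
  proof -
    have "(1 - \<i>) ^ 4 = -4"
      by (simp add: eval_nat_numeral algebra_simps)
    then show ?thesis
      by (simp add: power_mult)
  qed
  have sum: "(\<Sum>n\<in>{-2..2::int}. (1 + \<i> * of_int n) ^ (4 * k)) = 1 + 2 * (-4) ^ k + Q"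
    unfolding int_atLeastAtMost_m2_2 Q_def one_plus_2i_power4_sum[symmetric]
    using conj one_plus_i_power4(1)[of k] by (simp add: mult.commute)
  have aD: "of_real (coeff_a k) * of_real (coeff_a_bracket k) = (of_real (coeff_a_numerator k) / 2 ^ (4 * k) :: complex)"
    using D by (simp add: coeff_a_eq)
  have bracket: "complex_of_real (coeff_a_bracket k) = 5 ^ (4 * k + 1) - Q + 1"
    by (simp add: coeff_a_bracket_def Q_def)
  have num: "(2 ^ (4 * k + 1) - (-1) ^ k * 2 ^ (2 * k) - 1) = complex_of_real (coeff_a_numerator k) - 2"
    by (simp add: coeff_a_numerator_def)
  have gen: "a / 2 * (F - (1 + 2 * c + Q)) - (N - 2) / (2 * P) = 1 / P - a * (1 + c)"
    if "a * (F - Q + 1) = N / P" "P \<noteq> 0" for a F c Q N P :: complex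
  proof -
    have "a / 2 * (F - (1 + 2 * c + Q)) = (a * (F - Q + 1)) / 2 - a * (1 + c)"
      by (simp add: field_simps)
    also have "\<dots> = N / P / 2 - a * (1 + c)"
      by (simp only: that(1))
    also have "N / P / 2 = (N - 2) / (2 * P) + 1 / P"
      using that(2) by (simp add: field_simps)
    finally have eq: "a / 2 * (F - (1 + 2 * c + Q)) = (N - 2) / (2 * P) + 1 / P - a * (1 + c)" .
    show ?thesis
      unfolding eq by simp
  qed
  have P: "(2::complex) ^ (4 * k + 1) = 2 * 2 ^ (4 * k)"
    by simp
  show ?thesis
    unfolding coeff_b_def sum num unfolding P
    by (rule gen) (use aD[unfolded bracket] in simp_all)
qed

text \<open>Vanishing would make the bracket equal to the numerator times
  \<open>1 + (-4) ^ k\<close>, against the growth comparison.\<close>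

lemma coeff_b_nonzero:
  assumes k: "k \<ge> 1"
  shows "coeff_b k \<noteq> 0"
proof
  assume "coeff_b k = 0"
  then have "complex_of_real (1 / 2 ^ (4 * k) - coeff_a k * (1 + (-4) ^ k)) = 0"
    unfolding coeff_b_eq[OF k] by simp
  then have "1 / 2 ^ (4 * k) = coeff_a k * (1 + (-4) ^ k)"
    by (simp only: of_real_eq_0_iff)
  then have eq: "coeff_a_bracket k = coeff_a_numerator k * (1 + (-4) ^ k)"
    using coeff_a_bracket_pos[OF k] by (simp add: coeff_a_eq field_simps)
  have "(-4::real) ^ k \<le> 4 ^ k"
    by (cases "even k") (auto intro: order_trans[of _ 0])
  then have "coeff_a_numerator k * (1 + (-4) ^ k) \<le> coeff_a_numerator k * (1 + 4 ^ k)"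
    by (intro mult_left_mono coeff_a_numerator_nonneg) auto
  with eq coeff_a_numerator_less_bracket[OF k] show False
    by linarith
qed

section \<open>Combining the Laurent polynomials of the two Hecke relations\<close>

definition refl_coeff :: "nat \<Rightarrow> nat \<Rightarrow> complex" where
  "refl_coeff k j =
     of_real (coeff_a k) * (5 powi (4 * int k + 1 - 2 * int j) * (\<Sum>n\<in>{-2..2::int}. (1 + \<i> * of_int n) powi (2 * int j - 1)))
     - (1 + (1 + \<i>) powi (2 * int j - 1)) / 2 powi (2 * int j - 1)"

text \<open>Replacing \<open>j\<close> by \<open>2 * k + 1 - j\<close> exchanges the exponents
  \<open>2 * j - 1\<close> and \<open>4 * k + 1 - 2 * j\<close>, so \<open>coeff_c\<close> is
  antisymmetric under this reflection and \<open>refl_coeff\<close> collects one of its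
  halves.\<close>

lemma coeff_c_eq:
  assumes "j \<le> 2 * k + 1"
  shows "coeff_c j k = refl_coeff k (2 * k + 1 - j) - refl_coeff k j"
proof -
  have "4 * int k + 1 - 2 * int (2 * k + 1 - j) = 2 * int j - 1"
    "2 * int (2 * k + 1 - j) - 1 = 4 * int k + 1 - 2 * int j"
    using assms by (simp_all add: of_nat_diff)
  then show ?thesis
    unfolding coeff_c_def refl_coeff_def by (simp only:) (simp add: algebra_simps)
qed

text \<open>Every argument is \<open>\<i>\<close> times some \<open>1 + \<i> * n\<close>, divided by
  2 or 5. The powers of \<open>\<i>\<close> combine to \<open>\<i> ^ (2 * j) = (-1) ^ j\<close>, and
  the powers of 5 to the exponent \<open>4 * k + 1 - 2 * j\<close>.\<close>

lemma refl_coeff_eq: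
  "\<i> * (of_real (coeff_a k) * 5 ^ (4 * k) * ((\<i> / 5) powi (2 * int j - 1) + ((\<i> + 1) / 5) powi (2 * int j - 1) + ((\<i> - 1) / 5) powi (2 * int j - 1)
      + ((\<i> + 2) / 5) powi (2 * int j - 1) + ((\<i> - 2) / 5) powi (2 * int j - 1)) -
     ((\<i> / 2) powi (2 * int j - 1) + ((\<i> - 1) / 2) powi (2 * int j - 1))) = (-1) ^ j * refl_coeff k j"
proof -
  define e where "e = 2 * int j - 1"
  have ie: "\<i> * \<i> powi e = (-1) ^ j"
  proof -
    have "\<i> * \<i> powi e = \<i> powi (1 + e)"
      by (subst power_int_add) auto
    also have "1 + e = int (2 * j)"
      by (simp add: e_def)
    finally show ?thesis
      by (simp only: power_int_of_nat power_mult) simp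
  qed
  have five: "(5::complex) ^ (4 * k) / 5 powi e = 5 powi (4 * int k + 1 - 2 * int j)"
  proof -
    have "(5::complex) powi (4 * int k + 1 - 2 * int j) = 5 powi (int (4 * k) - e)"
      by (simp add: e_def algebra_simps)
    also have "\<dots> = 5 powi int (4 * k) / 5 powi e"
      by (subst power_int_diff) auto
    finally show ?thesis
      by (simp only: power_int_of_nat)
  qed
  have rot: "\<i> + 1 = \<i> * (1 - \<i>)" "\<i> - 1 = \<i> * (1 + \<i>)" "\<i> + 2 = \<i> * (1 - 2 * \<i>)" "\<i> - 2 = \<i> * (1 + 2 * \<i>)"
    by (simp_all add: complex_eq_iff)
  have sum: "(\<Sum>n\<in>{-2..2::int}. (1 + \<i> * of_int n) powi e) =
      1 + (1 - \<i>) powi e + (1 + \<i>) powi e + (1 - 2 * \<i>) powi e + (1 + 2 * \<i>) powi e"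
    unfolding int_atLeastAtMost_m2_2 by (simp add: mult.commute)
  show ?thesis
    unfolding refl_coeff_def e_def[symmetric] sum five[symmetric] ie[symmetric] rot
      power_int_divide_distrib power_int_mult_distrib
    by (simp add: algebra_simps add_divide_distrib)
qed

lemma sum_reflect_halves:
  fixes f :: "nat \<Rightarrow> complex"
  shows "(\<Sum>j=0..2*k+1. f j) = (\<Sum>j=0..k. f j + f (2 * k + 1 - j))"
proof -
  have "{0..2*k+1} = {0..k} \<union> (\<lambda>j. 2 * k + 1 - j) ` {0..k}"
  proof (intro equalityI subsetI)
    fix x assume "x \<in> {0..2*k+1}"
    then have "x \<le> k \<or> x = 2 * k + 1 - (2 * k + 1 - x) \<and> 2 * k + 1 - x \<in> {0..k}"
      by auto
    then show "x \<in> {0..k} \<union> (\<lambda>j. 2 * k + 1 - j) ` {0..k}"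
      by auto
  qed auto
  also have "sum f \<dots> = sum f {0..k} + sum f ((\<lambda>j. 2 * k + 1 - j) ` {0..k})"
    by (rule sum.union_disjoint) auto
  also have "sum f ((\<lambda>j. 2 * k + 1 - j) ` {0..k}) = (\<Sum>j=0..k. f (2 * k + 1 - j))"
    by (subst sum.reindex) (auto simp: inj_on_def)
  finally show ?thesis
    by (simp add: sum.distrib)
qed

text \<open>Under \<open>j \<mapsto> 2 * k + 1 - j\<close> the Bernoulli product is symmetric while
  \<open>(-1) ^ j\<close> changes sign, as \<open>2 * k + 1\<close> is odd. Folding the sum
  therefore leaves differences of \<open>refl_coeff\<close>, which are the values of
  \<open>coeff_c\<close>.\<close>

lemma refl_sum_combination:
  "\<i> * (of_real (coeff_a k) * 5 ^ (4 * k) * (refl_sum k (\<i> / 5) + refl_sum k ((\<i> + 1) / 5) + refl_sum k ((\<i> - 1) / 5)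
      + refl_sum k ((\<i> + 2) / 5) + refl_sum k ((\<i> - 2) / 5)) - (refl_sum k (\<i> / 2) + refl_sum k ((\<i> - 1) / 2))) =
   (\<Sum>j=0..k. (-1) ^ (j + 1) * coeff_c j k * bernoulli_prod (2 * k + 1) j)"
proof -
  have "\<i> * (of_real (coeff_a k) * 5 ^ (4 * k) * (refl_sum k (\<i> / 5) + refl_sum k ((\<i> + 1) / 5) + refl_sum k ((\<i> - 1) / 5)
      + refl_sum k ((\<i> + 2) / 5) + refl_sum k ((\<i> - 2) / 5)) - (refl_sum k (\<i> / 2) + refl_sum k ((\<i> - 1) / 2))) =
    (\<Sum>j=0..2*k+1. bernoulli_prod (2 * k + 1) j * ((-1) ^ j * refl_coeff k j))"
    unfolding refl_sum_def refl_coeff_eq[symmetric]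
    by (simp only: sum_distrib_left sum.distrib[symmetric] sum_subtractf[symmetric])
      (rule sum.cong, simp_all only: ring_distribs mult_ac)
  also have "\<dots> = (\<Sum>j=0..k. bernoulli_prod (2 * k + 1) j * ((-1) ^ j * refl_coeff k j) +
      bernoulli_prod (2 * k + 1) (2 * k + 1 - j) * ((-1) ^ (2 * k + 1 - j) * refl_coeff k (2 * k + 1 - j)))"
    by (rule sum_reflect_halves)
  also have "\<dots> = (\<Sum>j=0..k. (-1) ^ (j + 1) * coeff_c j k * bernoulli_prod (2 * k + 1) j)"
  proof (rule sum.cong)
    fix j assume j: "j \<in> {0..k}"
    have idx: "2 * (2 * k + 1) - 2 * (2 * k + 1 - j) = 2 * j" "2 * (2 * k + 1) - 2 * j = 2 * (2 * k + 1 - j)"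
      using j by auto
    have sym: "bernoulli_prod (2 * k + 1) (2 * k + 1 - j) = bernoulli_prod (2 * k + 1) j"
      unfolding bernoulli_prod_def idx by (simp only: mult.commute)
    have sgn: "(-1 :: complex) ^ (2 * k + 1 - j) = - ((-1) ^ j)"
      using j by (cases "even j") auto
    show "bernoulli_prod (2 * k + 1) j * ((-1) ^ j * refl_coeff k j) +
      bernoulli_prod (2 * k + 1) (2 * k + 1 - j) * ((-1) ^ (2 * k + 1 - j) * refl_coeff k (2 * k + 1 - j)) =
      (-1) ^ (j + 1) * coeff_c j k * bernoulli_prod (2 * k + 1) j"
      using j unfolding sym sgn by (subst coeff_c_eq) (auto simp: algebra_simps)
  qed simp
  finally show ?thesis .
qed

section \<open>Elimination of \<open>Z \<i>\<close> from the two Hecke relations\<close>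

theorem theorem3p4:
  fixes k :: nat
  assumes "k \<ge> 1"
  shows "zeta (of_nat (4 * k + 1)) =
      of_real ((2 * pi) ^ (4 * k + 1)) / (2 * coeff_b k) *
        (\<Sum>j = 0..k. (-1) ^ (j + 1) * coeff_c j k *
            of_real (bernoulli (2 * j)) * of_real (bernoulli (4 * k + 2 - 2 * j)) /
            (fact (2 * j) * fact (4 * k + 2 - 2 * j)))
      - 1 / (2 ^ (4 * k - 1) * coeff_b k) *
          lambert (of_real (exp (- 4 * pi))) (- 4 * of_nat k - 1)
      + (-1) ^ k * 2 ^ (2 * k + 1) * of_real (coeff_a k) / coeff_b k *
          lambert (- of_real (exp (- 5 * pi))) (- 4 * of_nat k - 1)
      + 2 * of_real (coeff_a k) / coeff_b k *
          lambert (of_real (exp (- 10 * pi))) (- 4 * of_nat k - 1)"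
proof -
  define z where "z = zeta (of_nat (4 * k + 1))"
  define L2 where "L2 = lambert (of_real (exp (- 4 * pi))) (- 4 * of_nat k - 1)"
  define Lh where "Lh = lambert (- of_real (exp (- 5 * pi))) (- 4 * of_nat k - 1)"
  define L5 where "L5 = lambert (of_real (exp (- 10 * pi))) (- 4 * of_nat k - 1)"
  define a where "a = complex_of_real (coeff_a k)"
  define C where "C = complex_of_real ((2 * pi) ^ (4 * k + 1))"
  define P where "P = (2::complex) ^ (4 * k)"
  define R2 where "R2 = refl_sum k (\<i> / 2) + refl_sum k ((\<i> - 1) / 2)"
  define R5 where "R5 = refl_sum k (\<i> / 5) + refl_sum k ((\<i> + 1) / 5) + refl_sum k ((\<i> - 1) / 5)
      + refl_sum k ((\<i> + 2) / 5) + refl_sum k ((\<i> - 2) / 5)"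
  define S where "S = (\<Sum>j = 0..k. (-1) ^ (j + 1) * coeff_c j k *
            of_real (bernoulli (2 * j)) * of_real (bernoulli (4 * k + 2 - 2 * j)) /
            (fact (2 * j) * fact (4 * k + 2 - 2 * j)))"
  have s: "- of_nat (4 * k + 1) = (- 4 * of_nat k - 1 :: complex)"
    by simp
  have "exp (2 * pi * \<i> * (2 * \<i>)) = complex_of_real (exp (- 4 * pi))"
    by (simp add: mult.assoc exp_of_real[symmetric] del: exp_of_real)
  then have Z2: "zeta_lambert (4 * k + 1) (2 * \<i>) = z + 2 * L2"
    unfolding zeta_lambert_def z_def L2_def s by simp
  have "exp (2 * pi * \<i> * (5 * \<i>)) = complex_of_real (exp (- 10 * pi))"
    by (simp add: mult.assoc exp_of_real[symmetric] del: exp_of_real)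
  then have Z5: "zeta_lambert (4 * k + 1) (5 * \<i>) = z + 2 * L5"
    unfolding zeta_lambert_def z_def L5_def s by simp
  \<comment> \<open>The real part \<open>1 / 2\<close> of this point contributes
    \<open>exp (pi * \<i>) = -1\<close>, which explains the negative argument of this Lambert
    series.\<close>
  have "2 * pi * \<i> * ((1 + 5 * \<i>) / 2) = pi * \<i> + complex_of_real (- 5 * pi)"
    by (simp add: complex_eq_iff)
  then have "exp (2 * pi * \<i> * ((1 + 5 * \<i>) / 2)) = - complex_of_real (exp (- 5 * pi))"
    by (simp only: exp_add exp_pi_i exp_of_real) simp
  then have Zh: "zeta_lambert (4 * k + 1) ((1 + 5 * \<i>) / 2) = z + 2 * Lh"
    unfolding zeta_lambert_def z_def Lh_def s by simp
  have P: "P \<noteq> 0"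
    by (simp add: P_def)
  \<comment> \<open>This is the purpose of \<open>coeff_a\<close>: multiplying the relation for 5 by
    \<open>a\<close> gives \<open>Z \<i>\<close> the same coefficient as in the relation for 2
    divided by \<open>P\<close>, so the two can be equated.\<close>
  have aD: "a * of_real (coeff_a_bracket k) = of_real (coeff_a_numerator k) / P"
    using coeff_a_bracket_pos[OF assms] by (simp add: a_def P_def coeff_a_eq)
  have E2: "2 * (z + 2 * L2) / P + \<i> * C * R2 = of_real (coeff_a_numerator k) / P * zeta_lambert (4 * k + 1) \<i>"
    using hecke_relation_2[OF assms] P unfolding Z2 R2_def[symmetric] P_def[symmetric] C_def[symmetric]
    by (simp add: field_simps)
  have E5: "2 * (z + 2 * L5) + 2 * (-4) ^ k * (z + 2 * Lh) + 5 ^ (4 * k) * (\<i> * C * R5) =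
      of_real (coeff_a_bracket k) * zeta_lambert (4 * k + 1) \<i>"
    using hecke_relation_5[OF assms] unfolding Z5 Zh R5_def[symmetric] C_def[symmetric] .
  have "a * (2 * (z + 2 * L5) + 2 * (-4) ^ k * (z + 2 * Lh) + 5 ^ (4 * k) * (\<i> * C * R5)) =
      2 * (z + 2 * L2) / P + \<i> * C * R2"
    unfolding E5 E2 aD[symmetric] by (rule mult.assoc[symmetric])
  \<comment> \<open>The coefficient of \<open>z\<close> collected on the left is
    \<open>2 * coeff_b k\<close> in the form of \<open>coeff_b_eq\<close>.\<close>
  then have "2 * (z * (1 / P - a * (1 + (-4) ^ k))) =
      C * (\<i> * (a * 5 ^ (4 * k) * R5 - R2)) - 4 / P * L2 + 4 * (-4) ^ k * a * Lh + 4 * a * L5"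
    by (simp add: algebra_simps add_divide_distrib)
  moreover have "\<i> * (a * 5 ^ (4 * k) * R5 - R2) = S"
  proof -
    have "4 * k + 2 - 2 * j = 2 * (2 * k + 1) - 2 * j" for j
      by simp
    then show ?thesis
      unfolding a_def R5_def R2_def S_def refl_sum_combination by (simp add: bernoulli_prod_def mult.assoc)
  qed
  ultimately have "2 * (z * coeff_b k) = C * S - 4 / P * L2 + 4 * (-4) ^ k * a * Lh + 4 * a * L5"
    unfolding coeff_b_eq[OF assms] a_def P_def by simp
  then have "z * coeff_b k = (C * S - 4 / P * L2 + 4 * (-4) ^ k * a * Lh + 4 * a * L5) / 2"
    by (simp add: mult.commute[of _ 2])
  then have main: "z * coeff_b k = C * S / 2 - 2 / P * L2 + 2 * (-4) ^ k * a * Lh + 2 * a * L5"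
    by (simp add: add_divide_distrib diff_divide_distrib)
  \<comment> \<open>The truncated subtraction in \<open>4 * k - 1\<close> is harmless because
    \<open>k \<ge> 1\<close>.\<close>
  have pow: "(2::complex) ^ (4 * k - 1) = P / 2" "(-1) ^ k * 2 ^ (2 * k + 1) = 2 * (-4 :: complex) ^ k"
  proof -
    show "(2::complex) ^ (4 * k - 1) = P / 2"
      using assms by (simp add: P_def power_diff)
    show "(-1) ^ k * 2 ^ (2 * k + 1) = 2 * (-4 :: complex) ^ k"
      by (simp add: power_mult flip: power_mult_distrib)
  qed
  have "z = (C * S / 2 - 2 / P * L2 + 2 * (-4) ^ k * a * Lh + 2 * a * L5) / coeff_b k"
    using main coeff_b_nonzero[OF assms] by (simp add: field_simps)
  also have "\<dots> = C / (2 * coeff_b k) * S - 1 / (P / 2 * coeff_b k) * L2 + 2 * (-4) ^ k * a / coeff_b k * Lh + 2 * a / coeff_b k * L5"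
    by (simp add: add_divide_distrib diff_divide_distrib)
  finally show ?thesis
    unfolding z_def[symmetric] L2_def[symmetric] Lh_def[symmetric] L5_def[symmetric] a_def[symmetric]
      C_def[symmetric] S_def[symmetric] pow .
qed

end
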